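(* Let $X_1,X_2,\ldots$ be an infinite sequence of commutative association schemes, and for $n\geq1$ let $W_n:=X_1\leftthreetimes X_2\leftthreetimes\cdots\leftthreetimes X_n$. Then the set of primitive idempotents of $W_n$ is $$J(W_n)=J_{X_1}\coprod (J_{X_2}\setminus\{j_0\})\coprod (J_{X_3}\setminus\{j_0\})\coprod\cdots\coprod(J_{X_n}\setminus\{j_0\}).$$ The inductive limit of these sets, along the maps $J(W_{n-1})\to J(W_n)$, $E\mapsto E\otimes\mathbf{J}_{X_n}$, induced by the projections $W_n\to W_{n-1}$, is $$\widehat{J}:=J_{X_1}\coprod\coprod_{i=2}^\infty (J_{X_i}\setminus\{j_0\}).$$
   Context: Association scheme: a triple $(X,R,I)$ with $X,I$ finite sets and $R:X\times X\to I$ a surjection. For $i\in I$ let $A_i$ be the $0/1$ matrix indexed by $X\times X$ with entry $1$ exactly on $R^{-1}(i)$, and let $A_X$ (the Bose-Mesner algebra) be the complex linear span of the $A_i$. The requirements are: (1) there is $i_0\in I$ with $A_{i_0}$ the identity matrix; (2) $A_X$ is closed under matrix product; (3) $A_X$ is closed under transpose. The scheme is commutative if $A_X$ is commutative under matrix product; then $A_X\cong\mathbb{C}^{\#I}$ as a ring. Normalization: $A_X$ carries the convolution product $A\bullet B:=\frac{1}{\#X}AB$. For commutative $X$, $J_X=J(X)$ denotes the set of primitive idempotents of $A_X$ with respect to $\bullet$; these are $\#X$ times the primitive idempotents with respect to the matrix product. The element $j_0\in J_X$ corresponds to the all-ones matrix $\mathbf{J}_X$ (indexed by $X\times X$), i.e.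 to the matrix-product idempotent $\frac{1}{\#X}\mathbf{J}_X$. Wreath product of schemes $(X,R_X,I_X)$ and $(Y,R_Y,I_Y)$: the scheme $X\leftthreetimes Y$ with underlying set $X\times Y$, relation set $(I_X\setminus\{i_0\})\coprod I_Y$, and $R_{\leftthreetimes}((x,y),(x',y'))=R_X(x,x')\in I_X\setminus\{i_0\}$ if $x\neq x'$, and $=R_Y(y,y')\in I_Y$ if $x=x'$. The operation is associative and preserves commutativity. The projection $X\leftthreetimes Y\to X$ is a morphism of schemes (on relations: identity on $I_X\setminus\{i_0\}$, and $I_Y\to\{i_0\}$); pulling back functions on relations, it induces an injection $A_X\to A_{X\leftthreetimes Y}$, $A\mapsto A\otimes\mathbf{J}_Y$, preserving $\bullet$. Identification of idempotents: $J_X\coprod(J_Y\setminus\{j_0\})$ is identified with a subset of $A_{X\leftthreetimes Y}$ by sending $E\in J_X$ to $E\otimes\mathbf{J}_Y$ and $E\in J_Y\setminus\{j_0\}$ to $\#X\cdot(\mathbf{I}_X\otimes E)$, where $\mathbf{I}_X$ is the identity matrix indexed by $X$. For $W_n=W_{n-1}\leftthreetimes X_n$ this identification is applied inductively in $n$. *)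

theory Defs
  imports Complex_Main "HOL-Library.Function_Algebras" "HOL-Library.FuncSet"
begin

text \<open>
  A matrix indexed by \<open>V \<times> V\<close>, for a finite set \<open>V\<close> of points, is a function on all pairs
  that vanishes outside \<open>V \<times> V\<close>.  Zero and addition are the pointwise ones of
  \<open>Function_Algebras\<close>; the pointwise product from that theory is never used.
\<close>

type_synonym 'a sqmat = "'a \<times> 'a \<Rightarrow> complex"

definition mscale :: "complex \<Rightarrow> 'a sqmat \<Rightarrow> 'a sqmat" where
  "mscale c A = (\<lambda>p. c * A p)"

interpretation sqmat: vector_space mscale
  by unfold_locales (auto simp: mscale_def fun_eq_iff algebra_simps)

definition id_mat :: "'a set \<Rightarrow> 'a sqmat" where
  "id_mat V = (\<lambda>(x, y). if x \<in> V \<and> x = y then 1 else 0)"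

definition ones_mat :: "'a set \<Rightarrow> 'a sqmat" where
  "ones_mat V = (\<lambda>(x, y). if x \<in> V \<and> y \<in> V then 1 else 0)"

definition mat_prod :: "'a set \<Rightarrow> 'a sqmat \<Rightarrow> 'a sqmat \<Rightarrow> 'a sqmat" where
  "mat_prod V A B = (\<lambda>(x, y). \<Sum>z\<in>V. A (x, z) * B (z, y))"

definition mat_transpose :: "'a sqmat \<Rightarrow> 'a sqmat" where
  "mat_transpose A = (\<lambda>(x, y). A (y, x))"

definition tensor :: "'a sqmat \<Rightarrow> 'b sqmat \<Rightarrow> ('a \<times> 'b) sqmat" where
  "tensor A B = (\<lambda>((x, y), (x', y')). A (x, x') * B (y, y'))"


section \<open>Association schemes\<close>

record ('a, 'i) scheme =
  pts :: "'a set"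
  rels :: "'i set"
  rel :: "'a \<times> 'a \<Rightarrow> 'i"

definition adj :: "('a, 'i) scheme \<Rightarrow> 'i \<Rightarrow> 'a sqmat" where
  "adj S i = (\<lambda>(x, y). if x \<in> pts S \<and> y \<in> pts S \<and> rel S (x, y) = i then 1 else 0)"

definition bose_mesner :: "('a, 'i) scheme \<Rightarrow> 'a sqmat set" where
  "bose_mesner S = sqmat.span (adj S ` rels S)"

definition assoc_scheme :: "('a, 'i) scheme \<Rightarrow> bool" where
  "assoc_scheme S \<longleftrightarrow>
     finite (pts S) \<and> finite (rels S) \<and> rel S ` (pts S \<times> pts S) = rels S \<and>
     (\<exists>i0\<in>rels S. adj S i0 = id_mat (pts S)) \<and>
     (\<forall>A\<in>bose_mesner S. \<forall>B\<in>bose_mesner S. mat_prod (pts S) A B \<in> bose_mesner S) \<and>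
     (\<forall>A\<in>bose_mesner S. mat_transpose A \<in> bose_mesner S)"

definition comm_assoc_scheme :: "('a, 'i) scheme \<Rightarrow> bool" where
  "comm_assoc_scheme S \<longleftrightarrow>
     assoc_scheme S \<and>
     (\<forall>A\<in>bose_mesner S. \<forall>B\<in>bose_mesner S. mat_prod (pts S) A B = mat_prod (pts S) B A)"

text \<open>
  The index \<open>i\<^sub>0\<close>.  It is unique for every association scheme: \<open>pts S\<close> is nonempty because
  \<open>rels S\<close> is, and the matrices \<open>adj S i\<close> for \<open>i \<in> rels S\<close> are nonzero with disjoint supports.
\<close>

definition diag_rel :: "('a, 'i) scheme \<Rightarrow> 'i" where
  "diag_rel S = (THE i. i \<in> rels S \<and> adj S i = id_mat (pts S))"

text \<open>The matrix \<open>\<Sum>i\<in>rels S. c i * adj S i\<close> attached to a function \<open>c\<close> on relations.\<close>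

definition rel_mat :: "('a, 'i) scheme \<Rightarrow> ('i \<Rightarrow> complex) \<Rightarrow> 'a sqmat" where
  "rel_mat S c = (\<lambda>(x, y). if x \<in> pts S \<and> y \<in> pts S then c (rel S (x, y)) else 0)"

lemma rel_mat_eq_sum:
  fixes S :: "('a, 'i) scheme"
  assumes "finite (rels S)" and "rel S ` (pts S \<times> pts S) \<subseteq> rels S"
  shows "rel_mat S c = (\<Sum>i\<in>rels S. mscale (c i) (adj S i))"
proof
  fix p :: "'a \<times> 'a"
  obtain x y where p: "p = (x, y)" by (cases p)
  have sum_app: "(\<Sum>i\<in>F. mscale (c i) (adj S i)) p = (\<Sum>i\<in>F. mscale (c i) (adj S i) p)" for F
    by (induction F rule: infinite_finite_induct) auto
  show "rel_mat S c p = (\<Sum>i\<in>rels S. mscale (c i) (adj S i)) p"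
  proof (cases "x \<in> pts S \<and> y \<in> pts S")
    case True
    then have "rel S (x, y) \<in> rels S" using assms(2) by auto
    then show ?thesis
      unfolding sum_app using True assms(1)
      by (simp add: p rel_mat_def mscale_def adj_def if_distrib[of "\<lambda>t. _ * t"] cong: if_cong)
  next
    case False
    then show ?thesis
      unfolding sum_app by (auto simp: p rel_mat_def mscale_def adj_def)
  qed
qed

definition scheme_morphism ::
    "('a, 'i) scheme \<Rightarrow> ('b, 'j) scheme \<Rightarrow> ('a \<Rightarrow> 'b) \<Rightarrow> ('i \<Rightarrow> 'j) \<Rightarrow> bool" where
  "scheme_morphism S T f g \<longleftrightarrow>
     f \<in> pts S \<rightarrow> pts T \<and> g \<in> rels S \<rightarrow> rels T \<and>
     (\<forall>x\<in>pts S. \<forall>y\<in>pts S. rel T (f x, f y) = g (rel S (x, y)))"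


section \<open>Primitive idempotents\<close>

definition conv :: "'a set \<Rightarrow> 'a sqmat \<Rightarrow> 'a sqmat \<Rightarrow> 'a sqmat" where
  "conv V A B = mscale (1 / of_nat (card V)) (mat_prod V A B)"

definition prim_idems :: "('a, 'i) scheme \<Rightarrow> 'a sqmat set" where
  "prim_idems S = {E \<in> bose_mesner S. E \<noteq> 0 \<and> conv (pts S) E E = E \<and>
     (\<forall>F\<in>bose_mesner S. \<forall>G\<in>bose_mesner S.
        conv (pts S) F F = F \<and> conv (pts S) G G = G \<and>
        conv (pts S) F G = 0 \<and> conv (pts S) G F = 0 \<and> E = F + G \<longrightarrow> F = 0 \<or> G = 0)}"

abbreviation j0 :: "('a, 'i) scheme \<Rightarrow> 'a sqmat" where
  "j0 S \<equiv> ones_mat (pts S)"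


section \<open>Wreath products\<close>

definition wreath :: "('a, 'i) scheme \<Rightarrow> ('b, 'j) scheme \<Rightarrow> ('a \<times> 'b, 'i + 'j) scheme" where
  "wreath S T =
     \<lparr>pts = pts S \<times> pts T,
      rels = (rels S - {diag_rel S}) <+> rels T,
      rel = (\<lambda>((x, y), (x', y')).
               if x \<noteq> x' then Inl (rel S (x, x')) else Inr (rel T (y, y')))\<rparr>"

text \<open>
  The inclusion of \<open>J\<^sub>S \<Coprod> (J\<^sub>T - {j\<^sub>0})\<close> into the Bose-Mesner algebra of \<open>wreath S T\<close>.
\<close>

definition wreath_ident ::
    "('a, 'i) scheme \<Rightarrow> ('b, 'j) scheme \<Rightarrow> 'a sqmat + 'b sqmat \<Rightarrow> ('a \<times> 'b) sqmat" where
  "wreath_ident S T u =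
     (case u of
        Inl E \<Rightarrow> tensor E (ones_mat (pts T))
      | Inr E \<Rightarrow> mscale (of_nat (card (pts S))) (tensor (id_mat (pts S)) E))"

text \<open>
  The type of points of \<open>wreath S T\<close> differs from those of \<open>S\<close> and \<open>T\<close>, so iterated wreath
  products are moved to one common type: a point \<open>(\<dots>((x\<^sub>1, x\<^sub>2), x\<^sub>3)\<dots>, x\<^sub>n)\<close> of \<open>wreath_seq X n\<close>
  becomes the list \<open>[x\<^sub>1, \<dots>, x\<^sub>n]\<close>, and a relation of \<open>wreath_seq X n\<close> coming from \<open>i \<in> rels (X k)\<close>
  becomes \<open>(k, i)\<close>.  The two functions below rename points and relations of a scheme, and
  points of a matrix, along maps that are injective on the relevant sets.
\<close>

definition rename_scheme ::
    "('a \<Rightarrow> 'b) \<Rightarrow> ('i \<Rightarrow> 'j) \<Rightarrow> ('a, 'i) scheme \<Rightarrow> ('b, 'j) scheme" where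
  "rename_scheme f g S =
     \<lparr>pts = f ` pts S,
      rels = g ` rels S,
      rel = (\<lambda>(u, v). g (rel S (inv_into (pts S) f u, inv_into (pts S) f v)))\<rparr>"

definition rename_mat :: "('a \<Rightarrow> 'b) \<Rightarrow> 'a set \<Rightarrow> 'a sqmat \<Rightarrow> 'b sqmat" where
  "rename_mat f V A =
     (\<lambda>(u, v). if u \<in> f ` V \<and> v \<in> f ` V then A (inv_into V f u, inv_into V f v) else 0)"

definition snoc :: "'a list \<times> 'a \<Rightarrow> 'a list" where
  "snoc = (\<lambda>(xs, x). xs @ [x])"

definition tag_rel :: "nat \<Rightarrow> (nat \<times> 'i) + 'i \<Rightarrow> nat \<times> 'i" where
  "tag_rel n r = (case r of Inl q \<Rightarrow> q | Inr i \<Rightarrow> (n, i))"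

text \<open>Sequences are indexed from 1; \<open>wreath_seq X 0\<close> and \<open>ident X 0\<close> are left unspecified.\<close>

fun wreath_seq :: "(nat \<Rightarrow> ('a, 'i) scheme) \<Rightarrow> nat \<Rightarrow> ('a list, nat \<times> 'i) scheme" where
  "wreath_seq X (Suc 0) = rename_scheme (\<lambda>x. [x]) (\<lambda>i. (1, i)) (X 1)"
| "wreath_seq X (Suc (Suc n)) =
     rename_scheme snoc (tag_rel (Suc (Suc n)))
       (wreath (wreath_seq X (Suc n)) (X (Suc (Suc n))))"

text \<open>
  The inclusion of \<open>J (X 1) \<Coprod> (J (X 2) - {j\<^sub>0}) \<Coprod> \<dots> \<Coprod> (J (X n) - {j\<^sub>0})\<close> into the
  Bose-Mesner algebra of \<open>wreath_seq X n\<close>, where \<open>(i, E)\<close> stands for \<open>E\<close> in the \<open>i\<close>-th summand.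
\<close>

fun ident :: "(nat \<Rightarrow> ('a, 'i) scheme) \<Rightarrow> nat \<Rightarrow> nat \<times> 'a sqmat \<Rightarrow> 'a list sqmat" where
  "ident X (Suc 0) (i, E) = rename_mat (\<lambda>x. [x]) (pts (X 1)) E"
| "ident X (Suc (Suc n)) (i, E) =
     rename_mat snoc (pts (wreath_seq X (Suc n)) \<times> pts (X (Suc (Suc n))))
       (wreath_ident (wreath_seq X (Suc n)) (X (Suc (Suc n)))
          (if i = Suc (Suc n) then Inr E else Inl (ident X (Suc n) (i, E))))"

definition J_summand :: "(nat \<Rightarrow> ('a, 'i) scheme) \<Rightarrow> nat \<Rightarrow> 'a sqmat set" where
  "J_summand X i = (if i = 1 then prim_idems (X 1) else prim_idems (X i) - {j0 (X i)})"

definition J_upto :: "(nat \<Rightarrow> ('a, 'i) scheme) \<Rightarrow> nat \<Rightarrow> (nat \<times> 'a sqmat) set" where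
  "J_upto X n = (SIGMA i:{1..n}. J_summand X i)"

definition J_hat :: "(nat \<Rightarrow> ('a, 'i) scheme) \<Rightarrow> (nat \<times> 'a sqmat) set" where
  "J_hat X = (SIGMA i:{1..}. J_summand X i)"

text \<open>
  \<open>A \<mapsto> A \<otimes> ones\<close>, from matrices on \<open>wreath_seq X n\<close> to matrices on
  \<open>wreath_seq X (Suc n)\<close>, for \<open>n \<ge> 1\<close>.
\<close>

definition trans_map :: "(nat \<Rightarrow> ('a, 'i) scheme) \<Rightarrow> nat \<Rightarrow> 'a list sqmat \<Rightarrow> 'a list sqmat" where
  "trans_map X n A =
     rename_mat snoc (pts (wreath_seq X n) \<times> pts (X (Suc n)))
       (tensor A (ones_mat (pts (X (Suc n)))))"

text \<open>
  The projection from \<open>wreath_seq X (Suc n)\<close> to \<open>wreath_seq X n\<close> is \<open>butlast\<close> on points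
  and the following map on relations.
\<close>

definition proj_rel :: "(nat \<Rightarrow> ('a, 'i) scheme) \<Rightarrow> nat \<Rightarrow> nat \<times> 'i \<Rightarrow> nat \<times> 'i" where
  "proj_rel X n = (\<lambda>(k, i). if k = Suc n then diag_rel (wreath_seq X n) else (k, i))"


section \<open>Inductive limits of sequences of sets\<close>

text \<open>
  For sets \<open>D n\<close> (\<open>n \<ge> 1\<close>) and maps \<open>t n\<close> from \<open>D n\<close> to \<open>D (Suc n)\<close>, the composite from \<open>D m\<close>
  to \<open>D k\<close> is \<open>fold t [m..<k]\<close>.
\<close>

definition ind_rel ::
    "(nat \<Rightarrow> 'a set) \<Rightarrow> (nat \<Rightarrow> 'a \<Rightarrow> 'a) \<Rightarrow> ((nat \<times> 'a) \<times> (nat \<times> 'a)) set" where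
  "ind_rel D t =
     {((m, a), (n, b)). (m, a) \<in> Sigma {1..} D \<and> (n, b) \<in> Sigma {1..} D \<and>
        (\<exists>k. m \<le> k \<and> n \<le> k \<and> fold t [m..<k] a = fold t [n..<k] b)}"

definition ind_lim :: "(nat \<Rightarrow> 'a set) \<Rightarrow> (nat \<Rightarrow> 'a \<Rightarrow> 'a) \<Rightarrow> (nat \<times> 'a) set set" where
  "ind_lim D t = Sigma {1..} D // ind_rel D t"

definition ind_class :: "(nat \<Rightarrow> 'a set) \<Rightarrow> (nat \<Rightarrow> 'a \<Rightarrow> 'a) \<Rightarrow> nat \<Rightarrow> 'a \<Rightarrow> (nat \<times> 'a) set" where
  "ind_class D t n a = ind_rel D t `` {(n, a)}"

end

theory Submission
  imports Defs
begin

text \<open>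
  Everything rests on a Peirce decomposition.  Let \<open>S\<close> and \<open>T\<close> be commutative schemes, \<open>I\<close> the
  identity matrix of \<open>S\<close>, and \<open>J\<close> the all-ones matrix of \<open>T\<close>.  The Bose-Mesner algebra of the
  wreath product consists of the matrices \<open>A \<otimes> J + I \<otimes> B\<close> (\<open>bose_mesner_wreath\<close>).  It contains the
  idempotent \<open>e = #S (I \<otimes> J)\<close>.  Since \<open>T\<close> is commutative, \<open>J \<bullet> B\<close> is a multiple of \<open>J\<close> for every
  \<open>B\<close>; hence the corner of \<open>e\<close> is \<open>{A \<otimes> J}\<close>, a copy of the algebra of \<open>S\<close>, and the annihilator of
  \<open>e\<close> is \<open>{I \<otimes> B | J \<bullet> B = 0}\<close>, a copy of the annihilator of \<open>j\<^sub>0\<close> in the algebra of \<open>T\<close>.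

  A primitive idempotent of a commutative ring lies either in the corner or in the annihilator of
  any given idempotent (\<open>peirce_decomposition\<close>), and being primitive there is the same as being
  primitive in the whole ring.  Applied to \<open>j\<^sub>0\<close> in the algebra of \<open>T\<close>, whose corner is \<open>\<complex> j\<^sub>0\<close>,
  this shows that the annihilator of \<open>j\<^sub>0\<close> has the primitive idempotents of \<open>T\<close> except \<open>j\<^sub>0\<close>.
  Applied to \<open>e\<close> it gives the bijection for one wreath product (\<open>bij_betw_wreath_ident\<close>).

  The result for \<open>n\<close> factors follows by induction, after transport along the renaming of points and
  relations, which is an isomorphism of Bose-Mesner algebras.  The identifications turn
  the transition maps into inclusions of the finite disjoint unions (\<open>trans_map_ident\<close>), and the
  inductive limit of an increasing sequence of sets is its union (\<open>ind_lim_increasing_union\<close>).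
\<close>


section \<open>Primitive idempotents of commutative rings\<close>

text \<open>
  A commutative ring without a distinguished unit, so that the annihilator of an idempotent, whose
  unit in general differs from that of the ambient ring, is again an instance.
\<close>

locale comm_ring_on =
  fixes A :: "'r::ab_group_add set" and mult :: "'r \<Rightarrow> 'r \<Rightarrow> 'r" (infixl "\<odot>" 70)
  assumes zero_mem: "0 \<in> A"
    and diff_mem: "x \<in> A \<Longrightarrow> y \<in> A \<Longrightarrow> x - y \<in> A"
    and mult_mem: "x \<in> A \<Longrightarrow> y \<in> A \<Longrightarrow> x \<odot> y \<in> A"
    and mult_commute: "x \<in> A \<Longrightarrow> y \<in> A \<Longrightarrow> x \<odot> y = y \<odot> x"
    and mult_assoc: "x \<in> A \<Longrightarrow> y \<in> A \<Longrightarrow> z \<in> A \<Longrightarrow> (x \<odot> y) \<odot> z = x \<odot> (y \<odot> z)"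
    and distrib: "x \<in> A \<Longrightarrow> y \<in> A \<Longrightarrow> z \<in> A \<Longrightarrow> x \<odot> (y + z) = x \<odot> y + x \<odot> z"

definition primitive_idems :: "'r::ab_group_add set \<Rightarrow> ('r \<Rightarrow> 'r \<Rightarrow> 'r) \<Rightarrow> 'r set" where
  "primitive_idems A m = {E \<in> A. E \<noteq> 0 \<and> m E E = E \<and>
     (\<forall>F\<in>A. \<forall>G\<in>A. m F F = F \<and> m G G = G \<and> m F G = 0 \<and> m G F = 0 \<and> E = F + G
        \<longrightarrow> F = 0 \<or> G = 0)}"

lemma primitive_idemsI:
  assumes "E \<in> A" "E \<noteq> 0" "m E E = E"
    and "\<And>F G. F \<in> A \<Longrightarrow> G \<in> A \<Longrightarrow> m F F = F \<Longrightarrow> m G G = G \<Longrightarrow> m F G = 0 \<Longrightarrow> F = 0 \<or> G = 0"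
  shows "E \<in> primitive_idems A m"
  unfolding primitive_idems_def using assms by blast

lemma primitive_idemsD:
  assumes "E \<in> primitive_idems A m"
  shows "E \<in> A" "E \<noteq> 0" "m E E = E"
  using assms unfolding primitive_idems_def by blast+

lemma prim_idems_eq: "prim_idems S = primitive_idems (bose_mesner S) (conv (pts S))"
  by (simp add: prim_idems_def primitive_idems_def)

context comm_ring_on
begin

lemma add_mem: "x \<in> A \<Longrightarrow> y \<in> A \<Longrightarrow> x + y \<in> A"
  using diff_mem[of x "0 - y"] diff_mem[of 0 y] zero_mem by simp

lemma mult_zero: "x \<in> A \<Longrightarrow> x \<odot> 0 = 0"
  using distrib[of x 0 0] zero_mem by simp

lemma distrib_diff: "x \<in> A \<Longrightarrow> y \<in> A \<Longrightarrow> z \<in> A \<Longrightarrow> x \<odot> (y - z) = x \<odot> y - x \<odot> z"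
  using distrib[of x "y - z" z] diff_mem by (simp add: algebra_simps)

text \<open>
  A decomposition \<open>E = F + G\<close> into orthogonal idempotents never leaves an ideal that contains
  \<open>E\<close>, because \<open>F = F \<odot> E\<close> and \<open>G = G \<odot> E\<close>.  Primitivity in the ideal is therefore the same as
  primitivity in the whole ring.
\<close>

lemma primitive_idems_ideal:
  assumes "B \<subseteq> A" and ideal: "\<And>x y. x \<in> A \<Longrightarrow> y \<in> B \<Longrightarrow> x \<odot> y \<in> B"
  shows "primitive_idems B (\<odot>) = primitive_idems A (\<odot>) \<inter> B"
proof -
  have summand: "F \<in> B"
    if "F + G \<in> B" "F \<in> A" "G \<in> A" "F \<odot> F = F" "F \<odot> G = 0" for F G
    using ideal[OF that(2,1)] distrib[OF that(2,2,3)] that(4,5) by simp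
  have summand': "F \<in> B \<and> G \<in> B"
    if "F + G \<in> B" "F \<in> A" "G \<in> A" "F \<odot> F = F" "G \<odot> G = G" "F \<odot> G = 0" "G \<odot> F = 0" for F G
    using summand[of F G] summand[of G F] that by (simp add: add.commute)
  have "E \<in> primitive_idems B (\<odot>) \<longleftrightarrow> E \<in> primitive_idems A (\<odot>)" if "E \<in> B" for E
    unfolding primitive_idems_def mem_Collect_eq
    using that \<open>B \<subseteq> A\<close> summand' by blast
  moreover have "primitive_idems B (\<odot>) \<subseteq> B"
    by (auto simp: primitive_idems_def)
  ultimately show ?thesis by blast
qed

text \<open>
  For idempotents \<open>e\<close> and \<open>E\<close> of a commutative ring, \<open>E = e \<odot> E + (E - e \<odot> E)\<close> is a decomposition
  into orthogonal idempotents.  If \<open>E\<close> is primitive, then one summand vanishes, so \<open>E\<close> lies in the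
  corner of \<open>e\<close> or in its annihilator; both are ideals.
\<close>

lemma peirce_decomposition:
  assumes e: "e \<in> A" "e \<odot> e = e"
  shows "primitive_idems A (\<odot>) =
    primitive_idems {x \<in> A. e \<odot> x = x} (\<odot>) \<union> primitive_idems {x \<in> A. e \<odot> x = 0} (\<odot>)"
proof -
  have swap: "e \<odot> (x \<odot> y) = x \<odot> (e \<odot> y)" if "x \<in> A" "y \<in> A" for x y
    using that e by (metis mult_assoc mult_commute)
  have 1: "primitive_idems {x \<in> A. e \<odot> x = x} (\<odot>)
      = primitive_idems A (\<odot>) \<inter> {x \<in> A. e \<odot> x = x}"
    by (rule primitive_idems_ideal) (auto simp: mult_mem swap)
  have 2: "primitive_idems {x \<in> A. e \<odot> x = 0} (\<odot>)
      = primitive_idems A (\<odot>) \<inter> {x \<in> A. e \<odot> x = 0}"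
    by (rule primitive_idems_ideal) (auto simp: mult_mem swap mult_zero)
  have "e \<odot> E = E \<or> e \<odot> E = 0" if E: "E \<in> primitive_idems A (\<odot>)" for E
  proof -
    define F where "F = e \<odot> E"
    have EA: "E \<in> A" and EE: "E \<odot> E = E"
      and split: "\<And>F G. F \<in> A \<Longrightarrow> G \<in> A \<Longrightarrow> F \<odot> F = F \<Longrightarrow> G \<odot> G = G \<Longrightarrow>
        F \<odot> G = 0 \<Longrightarrow> G \<odot> F = 0 \<Longrightarrow> E = F + G \<Longrightarrow> F = 0 \<or> G = 0"
      using E by (auto simp: primitive_idems_def)
    have FA: "F \<in> A" using EA e mult_mem by (simp add: F_def)
    have FE: "F \<odot> E = F" using EA EE e by (simp add: F_def mult_assoc)
    have eF: "e \<odot> F = F"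
      unfolding F_def using EA e by (simp flip: mult_assoc)
    have FF: "F \<odot> F = F"
      using swap[OF FA EA] FE eF by (simp add: F_def)
    have GA: "E - F \<in> A" using EA FA diff_mem by simp
    have FG: "F \<odot> (E - F) = 0" using EA FA FE FF by (simp add: distrib_diff)
    have GF: "(E - F) \<odot> F = 0" using FG FA GA mult_commute by simp
    have "(E - F) \<odot> E = E - F"
      using EA FA GA EE FE mult_commute[OF FA EA] mult_commute[OF GA EA]
      by (simp add: distrib_diff)
    then have GG: "(E - F) \<odot> (E - F) = E - F"
      using GF EA FA GA by (simp add: distrib_diff)
    have "F = 0 \<or> E - F = 0"
      using split[OF FA GA FF GG FG GF] by simp
    then show ?thesis by (auto simp: F_def)
  qed
  then show ?thesis
    unfolding 1 2 by (auto simp: primitive_idems_def)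
qed

lemma comm_ring_on_annihilator:
  assumes "e \<in> A"
  shows "comm_ring_on {x \<in> A. e \<odot> x = 0} (\<odot>)"
proof (rule comm_ring_on.intro)
  let ?N = "{x \<in> A. e \<odot> x = 0}"
  show "0 \<in> ?N" using assms by (simp add: zero_mem mult_zero)
  fix x y
  assume "x \<in> ?N" "y \<in> ?N"
  then have x: "x \<in> A" "e \<odot> x = 0" and y: "y \<in> A" "e \<odot> y = 0" by simp_all
  show "x - y \<in> ?N" using assms x y by (simp add: diff_mem distrib_diff)
  have "0 \<odot> y = 0" using mult_commute[OF zero_mem y(1)] mult_zero[OF y(1)] by (rule trans)
  then have "e \<odot> (x \<odot> y) = 0" using mult_assoc[OF assms x(1) y(1)] x(2) by metis
  then show "x \<odot> y \<in> ?N" using mult_mem[OF x(1) y(1)] by blast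
  show "x \<odot> y = y \<odot> x" using x(1) y(1) by (rule mult_commute)
  fix z
  assume "z \<in> ?N"
  then have z: "z \<in> A" by simp
  show "(x \<odot> y) \<odot> z = x \<odot> (y \<odot> z)" using x(1) y(1) z by (rule mult_assoc)
  show "x \<odot> (y + z) = x \<odot> y + x \<odot> z" using x(1) y(1) z by (rule distrib)
qed

lemma primitive_idems_image:
  assumes inj: "inj_on f A"
    and add: "\<And>x y. x \<in> A \<Longrightarrow> y \<in> A \<Longrightarrow> f (x + y) = f x + f y"
    and mult: "\<And>x y. x \<in> A \<Longrightarrow> y \<in> A \<Longrightarrow> f (x \<odot> y) = m (f x) (f y)"
  shows "primitive_idems (f ` A) m = f ` primitive_idems A (\<odot>)"
proof -
  have f0: "f 0 = 0" using add[OF zero_mem zero_mem] by simp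
  have eq: "f x = f y \<longleftrightarrow> x = y" if "x \<in> A" "y \<in> A" for x y
    using inj that by (auto dest: inj_onD)
  have eq0: "f x = 0 \<longleftrightarrow> x = 0" if "x \<in> A" for x
    using eq[OF that zero_mem] f0 by simp
  have "f E \<in> primitive_idems (f ` A) m \<longleftrightarrow> E \<in> primitive_idems A (\<odot>)" if "E \<in> A" for E
    unfolding primitive_idems_def
    using that by (auto simp: eq eq0 add[symmetric] mult[symmetric] add_mem mult_mem)
  moreover have "primitive_idems (f ` A) m \<subseteq> f ` A" "primitive_idems A (\<odot>) \<subseteq> A"
    by (auto simp: primitive_idems_def)
  ultimately show ?thesis by blast
qed

end


section \<open>Matrix algebra\<close>

lemma mat_prod_add_left: "mat_prod V (A + B) C = mat_prod V A C + mat_prod V B C"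
  by (auto simp: mat_prod_def fun_eq_iff algebra_simps sum.distrib)

lemma mat_prod_add_right: "mat_prod V C (A + B) = mat_prod V C A + mat_prod V C B"
  by (auto simp: mat_prod_def fun_eq_iff algebra_simps sum.distrib)

lemma mat_prod_mscale_left: "mat_prod V (mscale c A) B = mscale c (mat_prod V A B)"
  by (auto simp: mat_prod_def mscale_def fun_eq_iff sum_distrib_left mult.assoc)

lemma mat_prod_mscale_right: "mat_prod V A (mscale c B) = mscale c (mat_prod V A B)"
  by (auto simp: mat_prod_def mscale_def fun_eq_iff sum_distrib_left ac_simps)

lemma mat_prod_assoc: "mat_prod V (mat_prod V A B) C = mat_prod V A (mat_prod V B C)"
proof -
  have "(\<Sum>z\<in>V. (\<Sum>w\<in>V. A (x, w) * B (w, z)) * C (z, y)) =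
        (\<Sum>w\<in>V. A (x, w) * (\<Sum>z\<in>V. B (w, z) * C (z, y)))" for x y
    by (simp add: sum_distrib_left sum_distrib_right mult.assoc) (rule sum.swap)
  then show ?thesis by (simp add: mat_prod_def fun_eq_iff)
qed

lemma mat_prod_tensor:
  "mat_prod (V \<times> W) (tensor A B) (tensor C D) = tensor (mat_prod V A C) (mat_prod W B D)"
  by (auto simp: mat_prod_def tensor_def fun_eq_iff sum_product sum.cartesian_product
      intro!: sum.cong)

lemma tensor_add_left: "tensor (A + B) C = tensor A C + tensor B C"
  by (auto simp: tensor_def fun_eq_iff algebra_simps)

lemma tensor_add_right: "tensor C (A + B) = tensor C A + tensor C B"
  by (auto simp: tensor_def fun_eq_iff algebra_simps)

lemma tensor_diff_right: "tensor C (A - B) = tensor C A - tensor C B"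
  by (auto simp: tensor_def fun_eq_iff algebra_simps)

lemma tensor_mscale_left: "tensor (mscale c A) B = mscale c (tensor A B)"
  by (auto simp: tensor_def mscale_def fun_eq_iff)

lemma tensor_mscale_right: "tensor A (mscale c B) = mscale c (tensor A B)"
  by (auto simp: tensor_def mscale_def fun_eq_iff)

lemma tensor_zero_right: "tensor A 0 = 0"
  by (auto simp: tensor_def fun_eq_iff)

lemma mat_transpose_add: "mat_transpose (A + B) = mat_transpose A + mat_transpose B"
  by (auto simp: mat_transpose_def fun_eq_iff)

lemma mat_transpose_tensor:
  "mat_transpose (tensor A B) = tensor (mat_transpose A) (mat_transpose B)"
  by (auto simp: mat_transpose_def tensor_def fun_eq_iff)

lemma mat_transpose_id_mat: "mat_transpose (id_mat V) = id_mat V"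
  by (auto simp: mat_transpose_def id_mat_def fun_eq_iff)

lemma mat_transpose_ones_mat: "mat_transpose (ones_mat V) = ones_mat V"
  by (auto simp: mat_transpose_def ones_mat_def fun_eq_iff)

lemma mat_prod_ones_mat: "mat_prod V (ones_mat V) (ones_mat V) = mscale (of_nat (card V)) (ones_mat V)"
  by (auto simp: mat_prod_def ones_mat_def mscale_def fun_eq_iff)

lemma conv_add_right: "conv V A (B + C) = conv V A B + conv V A C"
  by (simp add: conv_def mat_prod_add_right sqmat.scale_right_distrib)

lemma conv_mscale_left: "conv V (mscale c A) B = mscale c (conv V A B)"
  by (simp add: conv_def mat_prod_mscale_left mult.commute)

lemma conv_mscale_right: "conv V A (mscale c B) = mscale c (conv V A B)"
  by (simp add: conv_def mat_prod_mscale_right mult.commute)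

lemma conv_assoc: "conv V (conv V A B) C = conv V A (conv V B C)"
  by (simp add: conv_def mat_prod_assoc mat_prod_mscale_left mat_prod_mscale_right)

lemma conv_tensor:
  "conv (V \<times> W) (tensor A B) (tensor C D) = tensor (conv V A C) (conv W B D)"
  by (simp add: conv_def mat_prod_tensor tensor_mscale_left tensor_mscale_right
      card_cartesian_product)

lemma conv_ones_mat:
  assumes "finite V" "V \<noteq> {}"
  shows "conv V (ones_mat V) (ones_mat V) = ones_mat V"
  using assms by (simp add: conv_def mat_prod_ones_mat)


section \<open>Bose-Mesner algebras\<close>

text \<open>
  The matrices \<open>adj S i\<close> are the indicators of the relations, so their span consists of all
  matrices whose entries depend only on the relation.
\<close>

lemma bose_mesner_eq_range:
  assumes "finite (rels S)" and "rel S ` (pts S \<times> pts S) \<subseteq> rels S"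
  shows "bose_mesner S = range (rel_mat S)"
proof
  have "adj S i = rel_mat S (\<lambda>k. if k = i then 1 else 0)" for i
    by (auto simp: adj_def rel_mat_def fun_eq_iff)
  then have "adj S ` rels S \<subseteq> range (rel_mat S)" by auto
  moreover have "sqmat.subspace (range (rel_mat S))"
  proof (rule sqmat.subspaceI)
    have "0 = rel_mat S (\<lambda>_. 0)" by (auto simp: rel_mat_def fun_eq_iff)
    then show "0 \<in> range (rel_mat S)" by blast
  next
    fix A B assume "A \<in> range (rel_mat S)" "B \<in> range (rel_mat S)"
    then obtain a b where "A = rel_mat S a" "B = rel_mat S b" by blast
    then have "A + B = rel_mat S (\<lambda>i. a i + b i)" by (auto simp: rel_mat_def fun_eq_iff)
    then show "A + B \<in> range (rel_mat S)" by blast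
  next
    fix c A assume "A \<in> range (rel_mat S)"
    then obtain a where "A = rel_mat S a" by blast
    then have "mscale c A = rel_mat S (\<lambda>i. c * a i)"
      by (auto simp: rel_mat_def mscale_def fun_eq_iff)
    then show "mscale c A \<in> range (rel_mat S)" by blast
  qed
  ultimately show "bose_mesner S \<subseteq> range (rel_mat S)"
    unfolding bose_mesner_def by (rule sqmat.span_minimal)
next
  show "range (rel_mat S) \<subseteq> bose_mesner S"
  proof (clarify, unfold bose_mesner_def rel_mat_eq_sum[OF assms])
    fix c
    show "(\<Sum>i\<in>rels S. mscale (c i) (adj S i)) \<in> sqmat.span (adj S ` rels S)"
      by (intro sqmat.span_sum sqmat.span_scale) (rule sqmat.span_base, rule imageI)
  qed
qed

locale comm_scheme =
  fixes S :: "('a, 'i) scheme"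
  assumes comm: "comm_assoc_scheme S"
begin

lemma finite_pts: "finite (pts S)"
  and finite_rels: "finite (rels S)"
  and rel_image: "rel S ` (pts S \<times> pts S) = rels S"
  and mat_prod_mem: "A \<in> bose_mesner S \<Longrightarrow> B \<in> bose_mesner S \<Longrightarrow> mat_prod (pts S) A B \<in> bose_mesner S"
  and transpose_mem: "A \<in> bose_mesner S \<Longrightarrow> mat_transpose A \<in> bose_mesner S"
  and mat_prod_commute:
    "A \<in> bose_mesner S \<Longrightarrow> B \<in> bose_mesner S \<Longrightarrow> mat_prod (pts S) A B = mat_prod (pts S) B A"
  using comm by (simp_all add: comm_assoc_scheme_def assoc_scheme_def)

lemma rel_mem: "x \<in> pts S \<Longrightarrow> y \<in> pts S \<Longrightarrow> rel S (x, y) \<in> rels S"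
  using rel_image by auto

lemma pts_nonempty: "pts S \<noteq> {}"
  using comm by (auto simp: comm_assoc_scheme_def assoc_scheme_def)

lemma card_pts_nonzero: "card (pts S) \<noteq> 0"
  using finite_pts pts_nonempty by simp

lemma diag_rel_props: "diag_rel S \<in> rels S \<and> adj S (diag_rel S) = id_mat (pts S)"
  unfolding diag_rel_def
proof (rule theI')
  obtain x where x: "x \<in> pts S" using pts_nonempty by blast
  obtain i where i: "i \<in> rels S" "adj S i = id_mat (pts S)"
    using comm by (auto simp: comm_assoc_scheme_def assoc_scheme_def)
  have "rel S (x, x) = k" if "adj S k = id_mat (pts S)" for k
    using fun_cong[OF that, of "(x, x)"] x by (auto simp: adj_def id_mat_def split: if_splits)
  then show "\<exists>!i. i \<in> rels S \<and> adj S i = id_mat (pts S)" using i by metis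
qed

lemma diag_rel_mem: "diag_rel S \<in> rels S"
  using diag_rel_props by blast

lemma rel_eq_diag_rel_iff:
  assumes "x \<in> pts S" "y \<in> pts S"
  shows "rel S (x, y) = diag_rel S \<longleftrightarrow> x = y"
  using fun_cong[OF diag_rel_props[THEN conjunct2], of "(x, y)"] assms
  by (auto simp: adj_def id_mat_def split: if_splits)

lemma bose_mesner_range: "bose_mesner S = range (rel_mat S)"
  using bose_mesner_eq_range finite_rels rel_image by blast

lemma bose_mesner_outside:
  assumes "A \<in> bose_mesner S" "x \<notin> pts S \<or> y \<notin> pts S"
  shows "A (x, y) = 0"
  using assms by (auto simp: bose_mesner_range rel_mat_def)

lemma zero_mem: "0 \<in> bose_mesner S"
  and add_mem: "A \<in> bose_mesner S \<Longrightarrow> B \<in> bose_mesner S \<Longrightarrow> A + B \<in> bose_mesner S"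
  and diff_mem: "A \<in> bose_mesner S \<Longrightarrow> B \<in> bose_mesner S \<Longrightarrow> A - B \<in> bose_mesner S"
  and mscale_mem: "A \<in> bose_mesner S \<Longrightarrow> mscale c A \<in> bose_mesner S"
  by (simp_all add: bose_mesner_def sqmat.span_zero sqmat.span_add sqmat.span_diff sqmat.span_scale)

lemma conv_mem: "A \<in> bose_mesner S \<Longrightarrow> B \<in> bose_mesner S \<Longrightarrow> conv (pts S) A B \<in> bose_mesner S"
  by (simp add: conv_def mat_prod_mem mscale_mem)

lemma id_mat_mem: "id_mat (pts S) \<in> bose_mesner S"
  using diag_rel_props unfolding bose_mesner_def by (metis image_eqI sqmat.span_base)

lemma ones_mat_mem: "ones_mat (pts S) \<in> bose_mesner S"
proof -
  have "ones_mat (pts S) = rel_mat S (\<lambda>_. 1)" by (auto simp: ones_mat_def rel_mat_def fun_eq_iff)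
  then show ?thesis by (simp add: bose_mesner_range)
qed

lemma mat_prod_id_left:
  assumes "A \<in> bose_mesner S" shows "mat_prod (pts S) (id_mat (pts S)) A = A"
proof -
  have "(\<Sum>z\<in>pts S. (if x \<in> pts S \<and> x = z then 1 else 0) * A (z, y)) = A (x, y)" for x y
    using finite_pts bose_mesner_outside[OF assms, of x y]
    by (cases "x \<in> pts S") (simp_all add: if_distrib[of "\<lambda>t. t * _"] cong: if_cong)
  then show ?thesis by (simp add: mat_prod_def id_mat_def fun_eq_iff)
qed

lemma mat_prod_id_right:
  assumes "A \<in> bose_mesner S" shows "mat_prod (pts S) A (id_mat (pts S)) = A"
  using mat_prod_commute[OF assms id_mat_mem] mat_prod_id_left[OF assms] by simp

text \<open>
  In a commutative scheme \<open>B\<close> commutes with the all-ones matrix \<open>J\<close>.  The entries of \<open>J B\<close> depend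
  only on the column and those of \<open>B J\<close> only on the row, so both products are multiples of \<open>J\<close>.
  Hence the span of \<open>J\<close> is an ideal.
\<close>

lemma mat_prod_ones_scalar:
  assumes "B \<in> bose_mesner S"
  obtains c where "mat_prod (pts S) (ones_mat (pts S)) B = mscale c (ones_mat (pts S))"
proof -
  define P where "P = mat_prod (pts S) (ones_mat (pts S)) B"
  have P_alt: "P = mat_prod (pts S) B (ones_mat (pts S))"
    unfolding P_def by (rule mat_prod_commute[OF ones_mat_mem assms])
  have column: "P (x, y) = P (x', y)" if "x \<in> pts S" "x' \<in> pts S" for x x' y
    using that by (simp add: P_def mat_prod_def ones_mat_def)
  have row: "P (x, y) = P (x, y')" if "y \<in> pts S" "y' \<in> pts S" for x y y'
    using that by (simp add: P_alt mat_prod_def ones_mat_def)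
  have P: "P \<in> bose_mesner S" unfolding P_def by (rule mat_prod_mem[OF ones_mat_mem assms])
  obtain a where a: "a \<in> pts S" using pts_nonempty by blast
  define p where "p = P (a, a)"
  have const: "P (x, y) = p" if "x \<in> pts S" "y \<in> pts S" for x y
    unfolding p_def using column[OF that(1) a, of y] row[OF that(2) a, of a] by (rule trans)
  have "P (x, y) = p * ones_mat (pts S) (x, y)" for x y
    using bose_mesner_outside[OF P, of x y] const[of x y]
    by (cases "x \<in> pts S \<and> y \<in> pts S") (auto simp: ones_mat_def)
  then have "P = mscale p (ones_mat (pts S))"
    by (auto simp: mscale_def fun_eq_iff)
  then show ?thesis unfolding P_def by (rule that)
qed

lemma conv_ones_scalar:
  assumes "B \<in> bose_mesner S"
  obtains c where "conv (pts S) (ones_mat (pts S)) B = mscale c (ones_mat (pts S))"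
proof -
  obtain b where "mat_prod (pts S) (ones_mat (pts S)) B = mscale b (ones_mat (pts S))"
    using mat_prod_ones_scalar[OF assms] by blast
  then have "conv (pts S) (ones_mat (pts S)) B
      = mscale (1 / of_nat (card (pts S)) * b) (ones_mat (pts S))"
    by (simp add: conv_def)
  then show ?thesis by (rule that)
qed

lemma conv_id_left:
  "A \<in> bose_mesner S \<Longrightarrow> conv (pts S) (id_mat (pts S)) A = mscale (1 / of_nat (card (pts S))) A"
  by (simp add: conv_def mat_prod_id_left)

lemma conv_commute:
  "A \<in> bose_mesner S \<Longrightarrow> B \<in> bose_mesner S \<Longrightarrow> conv (pts S) A B = conv (pts S) B A"
  by (simp add: conv_def mat_prod_commute)

sublocale ring: comm_ring_on "bose_mesner S" "conv (pts S)"
  by (rule comm_ring_on.intro)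
    (rule zero_mem diff_mem conv_mem conv_commute conv_assoc conv_add_right; assumption)+

lemma ones_mat_idem: "conv (pts S) (ones_mat (pts S)) (ones_mat (pts S)) = ones_mat (pts S)"
  using finite_pts pts_nonempty by (rule conv_ones_mat)

lemma ones_mat_nonzero: "ones_mat (pts S) \<noteq> 0"
proof -
  obtain x where "x \<in> pts S" using pts_nonempty by blast
  then have "ones_mat (pts S) (x, x) \<noteq> 0" by (simp add: ones_mat_def)
  then show ?thesis by auto
qed

text \<open>
  The corner of \<open>j\<^sub>0\<close> is the line \<open>\<complex> j\<^sub>0\<close>, whose only idempotents are \<open>0\<close> and \<open>j\<^sub>0\<close>.
\<close>

lemma primitive_idems_corner_ones:
  "primitive_idems {B \<in> bose_mesner S. conv (pts S) (j0 S) B = B} (conv (pts S)) = {j0 S}"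
  (is "primitive_idems ?C ?m = {?J}")
proof -
  have idem: "B = 0 \<or> B = ?J" if "B \<in> ?C" "?m B B = B" for B
  proof -
    have "B \<in> bose_mesner S" and JB: "?m ?J B = B" using that(1) by simp_all
    then obtain c where "?m ?J B = mscale c ?J" using conv_ones_scalar by blast
    then have c: "B = mscale c ?J" unfolding JB .
    have "mscale (c * c) ?J = mscale c ?J"
      using that(2) unfolding c by (simp add: conv_mscale_left conv_mscale_right ones_mat_idem)
    then have "c * c = c" using ones_mat_nonzero by simp
    then have "c = 0 \<or> c = 1" by simp
    then show ?thesis unfolding c by auto
  qed
  have J: "?J \<in> ?C" by (simp add: ones_mat_mem ones_mat_idem)
  have "F = 0 \<or> G = 0" if "F \<in> ?C" "G \<in> ?C" "?m F F = F" "?m G G = G" "?m F G = 0" for F G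
    using idem[OF that(1,3)] idem[OF that(2,4)] that(5) ones_mat_idem by metis
  then have "?J \<in> primitive_idems ?C ?m"
    by (rule primitive_idemsI[where m = ?m, OF J ones_mat_nonzero ones_mat_idem])
  moreover have "E = ?J" if "E \<in> primitive_idems ?C ?m" for E
    using idem[OF primitive_idemsD(1)[OF that] primitive_idemsD(3)[OF that]]
      primitive_idemsD(2)[OF that] by blast
  ultimately show ?thesis by blast
qed

text \<open>
  The Peirce decomposition with respect to \<open>j\<^sub>0\<close>, read backwards: removing \<open>j\<^sub>0\<close> from the primitive
  idempotents leaves those of the annihilator of \<open>j\<^sub>0\<close>.
\<close>

lemma primitive_idems_kernel_ones:
  "primitive_idems {B \<in> bose_mesner S. conv (pts S) (j0 S) B = 0} (conv (pts S))
    = prim_idems S - {j0 S}"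
proof -
  have "j0 S \<notin> primitive_idems {B \<in> bose_mesner S. conv (pts S) (j0 S) B = 0} (conv (pts S))"
    using primitive_idemsD(1) ones_mat_idem ones_mat_nonzero by fastforce
  then show ?thesis
    unfolding prim_idems_eq ring.peirce_decomposition[OF ones_mat_mem ones_mat_idem]
      primitive_idems_corner_ones
    by blast
qed

end


section \<open>Wreath products\<close>

locale wreath_factors = S: comm_scheme S + T: comm_scheme T
  for S :: "('a, 'i) scheme" and T :: "('b, 'j) scheme"
begin

abbreviation W :: "('a \<times> 'b, 'i + 'j) scheme" where
  "W \<equiv> wreath S T"

lemma pts_wreath: "pts W = pts S \<times> pts T"
  by (simp add: wreath_def)

lemma rel_wreath:
  "rel W ((x, y), (x', y')) = (if x \<noteq> x' then Inl (rel S (x, x')) else Inr (rel T (y, y')))"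
  by (simp add: wreath_def)

lemma rels_wreath: "rels W = (rels S - {diag_rel S}) <+> rels T"
  by (simp add: wreath_def)

lemma rel_wreath_image: "rel W ` (pts W \<times> pts W) = rels W"
proof
  show "rel W ` (pts W \<times> pts W) \<subseteq> rels W"
    by (auto simp: pts_wreath rel_wreath rels_wreath S.rel_mem T.rel_mem S.rel_eq_diag_rel_iff)
  obtain a b where a: "a \<in> pts S" and b: "b \<in> pts T"
    using S.pts_nonempty T.pts_nonempty by blast
  have "Inl i \<in> rel W ` (pts W \<times> pts W)" if i: "i \<in> rels S - {diag_rel S}" for i
  proof -
    obtain x x' where x: "x \<in> pts S" "x' \<in> pts S" "i = rel S (x, x')"
      using i S.rel_image by blast
    then have "Inl i = rel W ((x, b), (x', b))"
      using i S.rel_eq_diag_rel_iff by (auto simp: rel_wreath)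
    then show ?thesis using x b by (auto simp: pts_wreath)
  qed
  moreover have "Inr j \<in> rel W ` (pts W \<times> pts W)" if j: "j \<in> rels T" for j
  proof -
    obtain y y' where y: "y \<in> pts T" "y' \<in> pts T" "j = rel T (y, y')"
      using j T.rel_image by blast
    then have "Inr j = rel W ((a, y), (a, y'))" by (simp add: rel_wreath)
    then show ?thesis using y a by (auto simp: pts_wreath)
  qed
  ultimately show "rels W \<subseteq> rel W ` (pts W \<times> pts W)"
    unfolding rels_wreath by blast
qed

text \<open>
  A function on the relations of the wreath product is a function \<open>a\<close> on the off-diagonal relations
  of \<open>S\<close> together with a function \<open>b\<close> on the relations of \<open>T\<close>.  The first contributes
  \<open>A \<otimes> J\<close> off the diagonal of \<open>S\<close>, the second \<open>I \<otimes> B\<close> on it.  The two kinds of matrices overlap in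
  \<open>I \<otimes> J\<close>, so the decomposition is not unique.
\<close>

lemma bose_mesner_wreath:
  "bose_mesner W = {tensor A (j0 T) + tensor (id_mat (pts S)) B | A B.
     A \<in> bose_mesner S \<and> B \<in> bose_mesner T}" (is "_ = ?R")
proof
  have range: "bose_mesner W = range (rel_mat W)"
    by (rule bose_mesner_eq_range)
      (simp_all only: rel_wreath_image subset_refl,
       simp add: rels_wreath S.finite_rels T.finite_rels)
  show "bose_mesner W \<subseteq> ?R"
  proof
    fix M assume "M \<in> bose_mesner W"
    then obtain c where c: "M = rel_mat W c" using range by blast
    have "M = tensor (rel_mat S (\<lambda>i. if i = diag_rel S then 0 else c (Inl i))) (j0 T)
        + tensor (id_mat (pts S)) (rel_mat T (c \<circ> Inr))"
      unfolding c
      by (auto simp: fun_eq_iff rel_mat_def tensor_def id_mat_def ones_mat_def pts_wreath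
          rel_wreath S.rel_eq_diag_rel_iff)
    then show "M \<in> ?R" unfolding S.bose_mesner_range T.bose_mesner_range by blast
  qed
  show "?R \<subseteq> bose_mesner W"
  proof
    fix M assume "M \<in> ?R"
    then obtain a b where
      M: "M = tensor (rel_mat S a) (j0 T) + tensor (id_mat (pts S)) (rel_mat T b)"
      unfolding S.bose_mesner_range T.bose_mesner_range by blast
    have diag: "rel S (x, x) = diag_rel S" if "x \<in> pts S" for x
      using that S.rel_eq_diag_rel_iff by blast
    have "M = rel_mat W (case_sum a (\<lambda>j. a (diag_rel S) + b j))"
      unfolding M
      by (auto simp: fun_eq_iff rel_mat_def tensor_def id_mat_def ones_mat_def pts_wreath
          rel_wreath diag)
    then show "M \<in> bose_mesner W" unfolding range by blast
  qed
qed

text \<open>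
  The mixed products are \<open>(A \<otimes> J) (I \<otimes> B) = A \<otimes> J B\<close>, and \<open>J B\<close> is a multiple of \<open>J\<close>.  The
  formula shows that the Bose-Mesner algebra of the wreath product is closed under products.  As
  \<open>A A' = A' A\<close> and \<open>B B' = B' B\<close>, it is symmetric in the two factors, so the algebra is commutative.
\<close>

lemma mat_prod_wreath:
  assumes "A \<in> bose_mesner S" "A' \<in> bose_mesner S" "B \<in> bose_mesner T" "B' \<in> bose_mesner T"
    and b: "mat_prod (pts T) (j0 T) B = mscale b (j0 T)"
    and b': "mat_prod (pts T) (j0 T) B' = mscale b' (j0 T)"
  shows "mat_prod (pts W) (tensor A (j0 T) + tensor (id_mat (pts S)) B)
      (tensor A' (j0 T) + tensor (id_mat (pts S)) B') =
    tensor (mscale (of_nat (card (pts T))) (mat_prod (pts S) A A') + mscale b' A + mscale b A')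
        (j0 T)
      + tensor (id_mat (pts S)) (mat_prod (pts T) B B')"
proof -
  have "mat_prod (pts T) B (j0 T) = mscale b (j0 T)"
    using b assms(3) T.mat_prod_commute T.ones_mat_mem by metis
  then show ?thesis
    using assms
    by (simp add: pts_wreath mat_prod_add_left mat_prod_add_right mat_prod_tensor b'
        S.mat_prod_id_left S.mat_prod_id_right S.id_mat_mem mat_prod_ones_mat
        tensor_mscale_left tensor_mscale_right tensor_add_left)
qed

lemma comm_wreath: "comm_assoc_scheme W"
proof -
  let ?I = "id_mat (pts S)" and ?J = "j0 T"
  have gen: "tensor A ?J + tensor ?I B \<in> bose_mesner W"
    if "A \<in> bose_mesner S" "B \<in> bose_mesner T" for A B
    unfolding bose_mesner_wreath using that by blast
  have prod: "mat_prod (pts W) M N \<in> bose_mesner W \<and> mat_prod (pts W) M N = mat_prod (pts W) N M"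
    if "M \<in> bose_mesner W" "N \<in> bose_mesner W" for M N
  proof -
    obtain A B where M: "M = tensor A ?J + tensor ?I B"
      and A: "A \<in> bose_mesner S" and B: "B \<in> bose_mesner T"
      using \<open>M \<in> _\<close> unfolding bose_mesner_wreath by blast
    obtain A' B' where N: "N = tensor A' ?J + tensor ?I B'"
      and A': "A' \<in> bose_mesner S" and B': "B' \<in> bose_mesner T"
      using \<open>N \<in> _\<close> unfolding bose_mesner_wreath by blast
    obtain b where b: "mat_prod (pts T) ?J B = mscale b ?J" using T.mat_prod_ones_scalar[OF B] .
    obtain b' where b': "mat_prod (pts T) ?J B' = mscale b' ?J" using T.mat_prod_ones_scalar[OF B'] .
    have "mat_prod (pts W) M N \<in> bose_mesner W"
      unfolding M N mat_prod_wreath[OF A A' B B' b b']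
      by (intro gen S.add_mem S.mscale_mem S.mat_prod_mem T.mat_prod_mem A A' B B')
    moreover have "mat_prod (pts W) M N = mat_prod (pts W) N M"
      unfolding M N mat_prod_wreath[OF A A' B B' b b'] mat_prod_wreath[OF A' A B' B b' b]
        S.mat_prod_commute[OF A' A] T.mat_prod_commute[OF B' B]
      by (simp add: add.assoc add.commute[of "mscale b A'"])
    ultimately show ?thesis ..
  qed
  have transpose: "mat_transpose M \<in> bose_mesner W" if M: "M \<in> bose_mesner W" for M
  proof -
    obtain A B where "M = tensor A ?J + tensor ?I B"
      and "A \<in> bose_mesner S" "B \<in> bose_mesner T"
      using M unfolding bose_mesner_wreath by blast
    then show ?thesis
      by (simp add: mat_transpose_add mat_transpose_tensor mat_transpose_id_mat
          mat_transpose_ones_mat gen S.transpose_mem T.transpose_mem)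
  qed
  have "adj T (diag_rel T) = id_mat (pts T)"
    using T.diag_rel_props by blast
  then have "adj T (diag_rel T) (y, y') = id_mat (pts T) (y, y')" for y y' by simp
  then have "adj W (Inr (diag_rel T)) = id_mat (pts W)"
    by (auto simp: fun_eq_iff adj_def id_mat_def pts_wreath rel_wreath T.rel_eq_diag_rel_iff)
  moreover have "Inr (diag_rel T) \<in> rels W"
    unfolding rels_wreath using T.diag_rel_mem by (rule InrI)
  ultimately show ?thesis
    unfolding comm_assoc_scheme_def assoc_scheme_def
    using prod transpose rel_wreath_image
    by (auto simp: pts_wreath rels_wreath S.finite_pts T.finite_pts S.finite_rels T.finite_rels)
qed

sublocale W: comm_scheme W
  by unfold_locales (rule comm_wreath)

text \<open>
  The idempotent \<open>#S (I \<otimes> J)\<close>, the image of the unit \<open>#S I\<close> of the Bose-Mesner algebra of \<open>S\<close> and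
  also of \<open>j\<^sub>0\<close> of \<open>T\<close>.  Its corner is the contribution of \<open>S\<close> and its annihilator the contribution
  of \<open>T\<close>.
\<close>

abbreviation proj_idem :: "('a \<times> 'b) sqmat" where
  "proj_idem \<equiv> mscale (of_nat (card (pts S))) (tensor (id_mat (pts S)) (j0 T))"

lemma wreath_ident_Inl: "wreath_ident S T (Inl A) = tensor A (j0 T)"
  and wreath_ident_Inr:
    "wreath_ident S T (Inr B) = mscale (of_nat (card (pts S))) (tensor (id_mat (pts S)) B)"
  by (simp_all add: wreath_ident_def)

lemma wreath_ident_Inl_mem: "A \<in> bose_mesner S \<Longrightarrow> wreath_ident S T (Inl A) \<in> bose_mesner W"
proof -
  assume "A \<in> bose_mesner S"
  moreover have "tensor A (j0 T) = tensor A (j0 T) + tensor (id_mat (pts S)) 0"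
    by (simp add: tensor_zero_right)
  ultimately show ?thesis
    unfolding wreath_ident_Inl bose_mesner_wreath using T.zero_mem by blast
qed

lemma wreath_ident_Inr_mem: "B \<in> bose_mesner T \<Longrightarrow> wreath_ident S T (Inr B) \<in> bose_mesner W"
proof -
  assume B: "B \<in> bose_mesner T"
  have "tensor (id_mat (pts S)) B = tensor 0 (j0 T) + tensor (id_mat (pts S)) B"
    by (auto simp: tensor_def fun_eq_iff)
  then have "tensor (id_mat (pts S)) B \<in> bose_mesner W"
    unfolding bose_mesner_wreath using B S.zero_mem by blast
  then show ?thesis unfolding wreath_ident_Inr by (rule W.mscale_mem)
qed

lemma proj_idem_mem: "proj_idem \<in> bose_mesner W"
  using wreath_ident_Inr_mem[OF T.ones_mat_mem] by (simp add: wreath_ident_Inr)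

lemma conv_wreath_ident_Inl:
  "conv (pts W) (wreath_ident S T (Inl A)) (wreath_ident S T (Inl A'))
    = wreath_ident S T (Inl (conv (pts S) A A'))"
  by (simp add: wreath_ident_Inl pts_wreath conv_tensor T.ones_mat_idem)

lemma conv_wreath_ident_Inr:
  "conv (pts W) (wreath_ident S T (Inr B)) (wreath_ident S T (Inr B'))
    = wreath_ident S T (Inr (conv (pts T) B B'))"
  using S.card_pts_nonzero
  by (simp add: wreath_ident_Inr pts_wreath conv_mscale_left conv_mscale_right conv_tensor
      S.conv_id_left S.id_mat_mem tensor_mscale_left)

lemma conv_proj_idem_Inl:
  assumes "A \<in> bose_mesner S"
  shows "conv (pts W) proj_idem (wreath_ident S T (Inl A)) = wreath_ident S T (Inl A)"
  using S.card_pts_nonzero assms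
  by (simp add: wreath_ident_Inl pts_wreath conv_mscale_left conv_tensor
      S.conv_id_left tensor_mscale_left T.ones_mat_idem)

lemma conv_proj_idem_Inr:
  "conv (pts W) proj_idem (wreath_ident S T (Inr B)) = wreath_ident S T (Inr (conv (pts T) (j0 T) B))"
  using conv_wreath_ident_Inr[of "j0 T" B] by (simp only: wreath_ident_Inr)

lemma proj_idem_idem: "conv (pts W) proj_idem proj_idem = proj_idem"
  using conv_proj_idem_Inr[of "j0 T"] by (simp only: wreath_ident_Inr T.ones_mat_idem)

lemma inj_wreath_ident_Inl: "wreath_ident S T (Inl A) = wreath_ident S T (Inl A') \<longleftrightarrow> A = A'"
proof
  assume eq: "wreath_ident S T (Inl A) = wreath_ident S T (Inl A')"
  obtain y where y: "y \<in> pts T" using T.pts_nonempty by blast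
  show "A = A'"
  proof
    fix p show "A p = A' p"
      using fun_cong[OF eq, of "((fst p, y), (snd p, y))"] y
      by (simp add: wreath_ident_Inl tensor_def ones_mat_def)
  qed
qed simp

lemma inj_wreath_ident_Inr: "wreath_ident S T (Inr B) = wreath_ident S T (Inr B') \<longleftrightarrow> B = B'"
proof
  assume eq: "wreath_ident S T (Inr B) = wreath_ident S T (Inr B')"
  obtain x where x: "x \<in> pts S" using S.pts_nonempty by blast
  show "B = B'"
  proof
    fix p show "B p = B' p"
      using fun_cong[OF eq, of "((x, fst p), (x, snd p))"] x S.card_pts_nonzero
      by (simp add: wreath_ident_Inr mscale_def tensor_def id_mat_def)
  qed
qed simp

lemma wreath_ident_zero: "wreath_ident S T (Inl 0) = 0" "wreath_ident S T (Inr 0) = 0"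
  by (auto simp: wreath_ident_def tensor_def mscale_def fun_eq_iff)

text \<open>
  With \<open>M = A \<otimes> J + I \<otimes> B\<close> and \<open>J \<bullet> B = b J\<close>, the overlap \<open>b (I \<otimes> J)\<close> is moved from the second
  summand to the first.  What remains of \<open>B\<close> is annihilated by \<open>J\<close>, so the two new summands are the
  components of \<open>M\<close> in the corner and in the annihilator.
\<close>

lemma peirce_components:
  assumes "M \<in> bose_mesner W"
  obtains A B where "A \<in> bose_mesner S" "B \<in> bose_mesner T" "conv (pts T) (j0 T) B = 0"
    "M = wreath_ident S T (Inl A) + wreath_ident S T (Inr B)"
    "conv (pts W) proj_idem M = wreath_ident S T (Inl A)"
proof -
  obtain A B where M: "M = tensor A (j0 T) + tensor (id_mat (pts S)) B"
    and A: "A \<in> bose_mesner S" and B: "B \<in> bose_mesner T"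
    using assms unfolding bose_mesner_wreath by blast
  let ?n = "of_nat (card (pts S)) :: complex"
  obtain b where b: "conv (pts T) (j0 T) B = mscale b (j0 T)"
    using T.conv_ones_scalar[OF B] .
  \<comment> \<open>The factor compensates the scaling in \<open>wreath_ident\<close>.\<close>
  define B' where "B' = mscale (1 / ?n) (B - mscale b (j0 T))"
  have "M = tensor (A + mscale b (id_mat (pts S))) (j0 T)
      + tensor (id_mat (pts S)) (B - mscale b (j0 T))"
    by (simp add: M tensor_add_left tensor_diff_right tensor_mscale_left tensor_mscale_right)
  then have "M = wreath_ident S T (Inl (A + mscale b (id_mat (pts S)))) + wreath_ident S T (Inr B')"
    using S.card_pts_nonzero by (simp add: wreath_ident_Inl wreath_ident_Inr B'_def tensor_mscale_right)
  moreover have A': "A + mscale b (id_mat (pts S)) \<in> bose_mesner S"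
    by (intro S.add_mem S.mscale_mem A S.id_mat_mem)
  moreover have "B' \<in> bose_mesner T"
    unfolding B'_def by (intro T.mscale_mem T.diff_mem B T.ones_mat_mem)
  moreover have B'0: "conv (pts T) (j0 T) B' = 0"
    by (simp add: B'_def conv_mscale_right T.ring.distrib_diff T.ones_mat_mem B T.mscale_mem b
        T.ones_mat_idem)
  moreover have "conv (pts W) proj_idem
        (wreath_ident S T (Inl (A + mscale b (id_mat (pts S)))) + wreath_ident S T (Inr B'))
      = wreath_ident S T (Inl (A + mscale b (id_mat (pts S))))"
    by (simp only: conv_add_right conv_proj_idem_Inl[OF A'] conv_proj_idem_Inr B'0
        wreath_ident_zero add_0_right)
  ultimately show ?thesis using that by metis
qed

lemma corner_proj_idem:
  "{M \<in> bose_mesner W. conv (pts W) proj_idem M = M}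
    = (\<lambda>A. wreath_ident S T (Inl A)) ` bose_mesner S" (is "?C = ?R")
proof
  show "?C \<subseteq> ?R"
  proof
    fix M assume "M \<in> ?C"
    then have M: "M \<in> bose_mesner W" and eM: "conv (pts W) proj_idem M = M" by simp_all
    obtain A where "A \<in> bose_mesner S" "conv (pts W) proj_idem M = wreath_ident S T (Inl A)"
      using peirce_components[OF M] by blast
    then show "M \<in> ?R" using eM by (metis imageI)
  qed
qed (auto simp only: mem_Collect_eq wreath_ident_Inl_mem conv_proj_idem_Inl)

lemma annihilator_proj_idem:
  "{M \<in> bose_mesner W. conv (pts W) proj_idem M = 0}
    = (\<lambda>B. wreath_ident S T (Inr B)) ` {B \<in> bose_mesner T. conv (pts T) (j0 T) B = 0}"
    (is "?N = ?R")
proof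
  show "?N \<subseteq> ?R"
  proof
    fix M assume "M \<in> ?N"
    then have M: "M \<in> bose_mesner W" and eM: "conv (pts W) proj_idem M = 0" by simp_all
    obtain A B where B: "B \<in> bose_mesner T" "conv (pts T) (j0 T) B = 0"
      and "M = wreath_ident S T (Inl A) + wreath_ident S T (Inr B)"
      and "conv (pts W) proj_idem M = wreath_ident S T (Inl A)"
      using peirce_components[OF M] by blast
    then have "M = wreath_ident S T (Inr B)" using eM by simp
    then show "M \<in> ?R" using B by blast
  qed
qed (auto simp only: mem_Collect_eq wreath_ident_Inr_mem conv_proj_idem_Inr wreath_ident_zero)

text \<open>
  The corner of \<open>proj_idem\<close> is isomorphic to the Bose-Mesner algebra of \<open>S\<close>, and its annihilator to
  the annihilator of \<open>j\<^sub>0\<close> in that of \<open>T\<close>; \<open>wreath_ident\<close> is the union of these isomorphisms.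
\<close>

lemma bij_betw_wreath_ident:
  "bij_betw (wreath_ident S T) (prim_idems S <+> (prim_idems T - {j0 T})) (prim_idems W)"
proof -
  let ?K = "{B \<in> bose_mesner T. conv (pts T) (j0 T) B = 0}"
  interpret K: comm_ring_on ?K "conv (pts T)"
    by (rule T.ring.comm_ring_on_annihilator[OF T.ones_mat_mem])
  have l: "primitive_idems ((\<lambda>A. wreath_ident S T (Inl A)) ` bose_mesner S) (conv (pts W))
      = (\<lambda>A. wreath_ident S T (Inl A)) ` prim_idems S"
    unfolding prim_idems_eq
    by (rule S.ring.primitive_idems_image)
      (simp_all add: inj_on_def inj_wreath_ident_Inl conv_wreath_ident_Inl,
       simp add: wreath_ident_Inl tensor_add_left)
  have r: "primitive_idems ((\<lambda>B. wreath_ident S T (Inr B)) ` ?K) (conv (pts W))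
      = (\<lambda>B. wreath_ident S T (Inr B)) ` (prim_idems T - {j0 T})"
    unfolding T.primitive_idems_kernel_ones[symmetric]
    by (rule K.primitive_idems_image)
      (simp_all add: inj_on_def inj_wreath_ident_Inr conv_wreath_ident_Inr,
       simp add: wreath_ident_Inr tensor_add_right sqmat.scale_right_distrib)
  have "prim_idems W = wreath_ident S T ` (prim_idems S <+> (prim_idems T - {j0 T}))"
    unfolding prim_idems_eq[of W]
      W.ring.peirce_decomposition[OF proj_idem_mem proj_idem_idem]
      corner_proj_idem annihilator_proj_idem l r Plus_def image_Un image_image ..
  \<comment> \<open>The idempotent \<open>proj_idem\<close> fixes the left-hand side and kills the right-hand side.\<close>
  moreover have "wreath_ident S T (Inl A) \<noteq> wreath_ident S T (Inr B)"
    if A: "A \<in> prim_idems S" and B: "B \<in> prim_idems T - {j0 T}" for A B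
  proof
    assume eq: "wreath_ident S T (Inl A) = wreath_ident S T (Inr B)"
    have "A \<in> bose_mesner S" "A \<noteq> 0" using A by (simp_all add: prim_idems_def)
    moreover have "conv (pts T) (j0 T) B = 0"
      using B primitive_idemsD(1) unfolding T.primitive_idems_kernel_ones[symmetric] by blast
    ultimately have "wreath_ident S T (Inl A) = wreath_ident S T (Inl 0)"
      using conv_proj_idem_Inl[of A] conv_proj_idem_Inr[of B]
      by (simp only: eq wreath_ident_zero)
    then show False using \<open>A \<noteq> 0\<close> by (simp only: inj_wreath_ident_Inl)
  qed
  then have "inj_on (wreath_ident S T) (prim_idems S <+> (prim_idems T - {j0 T}))"
    by (intro inj_onI) (auto simp: inj_wreath_ident_Inl inj_wreath_ident_Inr dest: sym)
  ultimately show ?thesis by (simp add: bij_betw_def)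
qed

end


section \<open>Renaming points and relations\<close>

lemma rename_mat_apply:
  "inj_on f V \<Longrightarrow> x \<in> V \<Longrightarrow> y \<in> V \<Longrightarrow> rename_mat f V A (f x, f y) = A (x, y)"
  by (simp add: rename_mat_def)

lemma rename_mat_eqI:
  assumes "inj_on f V"
    and "\<And>x y. x \<in> V \<Longrightarrow> y \<in> V \<Longrightarrow> M (f x, f y) = A (x, y)"
    and "\<And>u v. u \<notin> f ` V \<or> v \<notin> f ` V \<Longrightarrow> M (u, v) = 0"
  shows "M = rename_mat f V A"
proof
  fix p :: "'b \<times> 'b"
  obtain u v where p: "p = (u, v)" by (cases p)
  show "M p = rename_mat f V A p"
  proof (cases "u \<in> f ` V \<and> v \<in> f ` V")
    case True
    then obtain x y where "x \<in> V" "y \<in> V" "u = f x" "v = f y" by blast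
    then show ?thesis using assms(1,2) by (simp add: p rename_mat_apply)
  next
    case False
    then have "M (u, v) = 0" using assms(3) by blast
    moreover have "rename_mat f V A (u, v) = 0" unfolding rename_mat_def using False by auto
    ultimately show ?thesis by (simp add: p)
  qed
qed

lemma rename_mat_add: "rename_mat f V (A + B) = rename_mat f V A + rename_mat f V B"
  by (auto simp: rename_mat_def fun_eq_iff)

lemma rename_mat_mscale: "rename_mat f V (mscale c A) = mscale c (rename_mat f V A)"
  by (auto simp: rename_mat_def mscale_def fun_eq_iff)

lemma rename_mat_transpose: "rename_mat f V (mat_transpose A) = mat_transpose (rename_mat f V A)"
  by (auto simp: rename_mat_def mat_transpose_def fun_eq_iff)

lemma rename_mat_prod:
  assumes "inj_on f V"
  shows "mat_prod (f ` V) (rename_mat f V A) (rename_mat f V B) = rename_mat f V (mat_prod V A B)"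
proof (rule rename_mat_eqI[OF assms])
  fix x y assume xy: "x \<in> V" "y \<in> V"
  have "mat_prod (f ` V) (rename_mat f V A) (rename_mat f V B) (f x, f y) =
      (\<Sum>z\<in>V. rename_mat f V A (f x, f z) * rename_mat f V B (f z, f y))"
    by (simp add: mat_prod_def sum.reindex[OF assms])
  also have "\<dots> = (\<Sum>z\<in>V. A (x, z) * B (z, y))"
    using assms xy by (intro sum.cong) (simp_all add: rename_mat_apply)
  finally show "mat_prod (f ` V) (rename_mat f V A) (rename_mat f V B) (f x, f y)
      = mat_prod V A B (x, y)"
    by (simp add: mat_prod_def)
next
  fix u v assume "u \<notin> f ` V \<or> v \<notin> f ` V"
  then show "mat_prod (f ` V) (rename_mat f V A) (rename_mat f V B) (u, v) = 0"
    by (auto simp: mat_prod_def rename_mat_def intro!: sum.neutral)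
qed

lemma conv_rename_mat:
  assumes "inj_on f V"
  shows "conv (f ` V) (rename_mat f V A) (rename_mat f V B) = rename_mat f V (conv V A B)"
  by (simp add: conv_def rename_mat_prod[OF assms] rename_mat_mscale card_image[OF assms])

text \<open>
  Renaming points along an injection is an isomorphism of Bose-Mesner algebras, so the scheme axioms
  and the primitive idempotents are transported.  Injectivity on relations keeps distinct
  relations from being merged, which would shrink the algebra.
\<close>

locale renamed_scheme = comm_scheme S for S :: "('a, 'i) scheme" +
  fixes f :: "'a \<Rightarrow> 'b" and g :: "'i \<Rightarrow> 'j"
  assumes inj_pts: "inj_on f (pts S)" and inj_rels: "inj_on g (rels S)"
begin

abbreviation R :: "('b, 'j) scheme" where
  "R \<equiv> rename_scheme f g S"

lemma pts_rename: "pts R = f ` pts S"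
  and rels_rename: "rels R = g ` rels S"
  by (simp_all add: rename_scheme_def)

lemma rel_rename:
  "x \<in> pts S \<Longrightarrow> y \<in> pts S \<Longrightarrow> rel R (f x, f y) = g (rel S (x, y))"
  using inj_pts by (simp add: rename_scheme_def)

lemma rel_rename_image: "rel R ` (pts R \<times> pts R) = rels R"
proof -
  have "rel R ` (pts R \<times> pts R) = (\<lambda>(x, y). rel R (f x, f y)) ` (pts S \<times> pts S)"
    unfolding pts_rename by force
  also have "\<dots> = (\<lambda>p. g (rel S p)) ` (pts S \<times> pts S)"
    by (rule image_cong) (auto simp: rel_rename)
  also have "\<dots> = g ` rels S"
    unfolding rel_image[symmetric] image_image ..
  finally show ?thesis by (simp only: rels_rename)
qed

lemma rename_rel_mat: "rel_mat R c = rename_mat f (pts S) (rel_mat S (c \<circ> g))"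
  by (rule rename_mat_eqI[OF inj_pts]) (auto simp: rel_mat_def pts_rename rel_rename)

lemma bose_mesner_rename: "bose_mesner R = rename_mat f (pts S) ` bose_mesner S"
proof -
  have "bose_mesner R = range (rel_mat R)"
    by (rule bose_mesner_eq_range)
      (simp_all only: rel_rename_image subset_refl, simp add: rels_rename finite_rels)
  also have "\<dots> = rename_mat f (pts S) ` range (rel_mat S)"
  proof
    show "range (rel_mat R) \<subseteq> rename_mat f (pts S) ` range (rel_mat S)"
      unfolding image_subset_iff using rename_rel_mat by blast
    have "rename_mat f (pts S) (rel_mat S c) = rel_mat R (c \<circ> inv_into (rels S) g)" for c
    proof -
      have "rel_mat S (c \<circ> inv_into (rels S) g \<circ> g) = rel_mat S c"
        using inj_rels by (auto simp: rel_mat_def fun_eq_iff rel_mem)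
      then show ?thesis by (simp only: rename_rel_mat)
    qed
    then show "rename_mat f (pts S) ` range (rel_mat S) \<subseteq> range (rel_mat R)"
      by blast
  qed
  finally show ?thesis unfolding bose_mesner_range .
qed

lemma comm_rename: "comm_assoc_scheme R"
proof -
  have "adj R (g (diag_rel S)) = rename_mat f (pts S) (adj S (diag_rel S))"
    by (rule rename_mat_eqI[OF inj_pts])
      (auto simp: adj_def pts_rename rel_rename rel_mem diag_rel_mem inj_on_eq_iff[OF inj_rels])
  moreover have "id_mat (pts R) = rename_mat f (pts S) (id_mat (pts S))"
    by (rule rename_mat_eqI[OF inj_pts])
      (auto simp: id_mat_def pts_rename inj_on_eq_iff[OF inj_pts])
  ultimately have "adj R (g (diag_rel S)) = id_mat (pts R)"
    using diag_rel_props by simp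
  then have "\<exists>i\<in>rels R. adj R i = id_mat (pts R)"
    using diag_rel_mem by (auto simp: rels_rename)
  moreover have "mat_prod (pts R) M N \<in> bose_mesner R \<and> mat_prod (pts R) M N = mat_prod (pts R) N M"
    if MN: "M \<in> bose_mesner R" "N \<in> bose_mesner R" for M N
  proof -
    obtain A B where A: "A \<in> bose_mesner S" "M = rename_mat f (pts S) A"
      and B: "B \<in> bose_mesner S" "N = rename_mat f (pts S) B"
      using MN unfolding bose_mesner_rename by blast
    show ?thesis
      unfolding A(2) B(2) pts_rename bose_mesner_rename rename_mat_prod[OF inj_pts]
        mat_prod_commute[OF A(1) B(1)]
      using mat_prod_mem[OF B(1) A(1)] by blast
  qed
  moreover have "mat_transpose M \<in> bose_mesner R" if "M \<in> bose_mesner R" for M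
    using that unfolding bose_mesner_rename
    by (auto simp: transpose_mem simp flip: rename_mat_transpose)
  moreover have "finite (pts R)" "finite (rels R)"
    by (simp_all add: pts_rename rels_rename finite_pts finite_rels)
  ultimately show ?thesis
    unfolding comm_assoc_scheme_def assoc_scheme_def using rel_rename_image by blast
qed

lemma bij_betw_rename_mat: "bij_betw (rename_mat f (pts S)) (prim_idems S) (prim_idems R)"
proof -
  have inj: "inj_on (rename_mat f (pts S)) (bose_mesner S)"
  proof
    fix A B
    assume AB: "A \<in> bose_mesner S" "B \<in> bose_mesner S"
      and eq: "rename_mat f (pts S) A = rename_mat f (pts S) B"
    have "A (x, y) = B (x, y)" for x y
      using fun_cong[OF eq, of "(f x, f y)"] bose_mesner_outside[OF AB(1), of x y]
        bose_mesner_outside[OF AB(2), of x y] rename_mat_apply[OF inj_pts]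
      by (cases "x \<in> pts S \<and> y \<in> pts S") auto
    then show "A = B" by auto
  qed
  have "prim_idems R = rename_mat f (pts S) ` prim_idems S"
    unfolding prim_idems_eq bose_mesner_rename pts_rename
    by (rule ring.primitive_idems_image[OF inj])
      (simp_all add: rename_mat_add conv_rename_mat[OF inj_pts])
  moreover have "inj_on (rename_mat f (pts S)) (prim_idems S)"
    using inj by (rule inj_on_subset) (auto simp: prim_idems_def)
  ultimately show ?thesis by (simp add: bij_betw_def)
qed

end


section \<open>Inductive limits of increasing unions\<close>

text \<open>
  If bijections \<open>\<phi> n : U n \<rightarrow> D n\<close> turn the transition maps into inclusions, then two elements
  \<open>\<phi> m p\<close> and \<open>\<phi> n q\<close> become equal at a later stage exactly when \<open>p = q\<close>.  The classes of the
  inductive limit are thus indexed by the union of the sets \<open>U n\<close>.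
\<close>

lemma ind_lim_increasing_union:
  fixes U :: "nat \<Rightarrow> 'p set" and D :: "nat \<Rightarrow> 'a set"
    and t :: "nat \<Rightarrow> 'a \<Rightarrow> 'a" and \<phi> :: "nat \<Rightarrow> 'p \<Rightarrow> 'a"
  assumes mono: "\<And>n. n \<ge> 1 \<Longrightarrow> U n \<subseteq> U (Suc n)"
    and bij: "\<And>n. n \<ge> 1 \<Longrightarrow> bij_betw (\<phi> n) (U n) (D n)"
    and compat: "\<And>n p. n \<ge> 1 \<Longrightarrow> p \<in> U n \<Longrightarrow> t n (\<phi> n p) = \<phi> (Suc n) p"
  shows "\<exists>\<Phi>. bij_betw \<Phi> (\<Union>n\<in>{1..}. U n) (ind_lim D t) \<and>
    (\<forall>n\<ge>1. \<forall>p\<in>U n. \<Phi> p = ind_class D t n (\<phi> n p))"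
proof -
  have fold: "p \<in> U k \<and> fold t [m..<k] (\<phi> m p) = \<phi> k p"
    if "1 \<le> m" "m \<le> k" "p \<in> U m" for m k p
    using that(2)
  proof (induction k rule: dec_induct)
    case base
    then show ?case using that by simp
  next
    case (step k)
    then show ?case using that mono[of k] compat[of k p] by auto
  qed
  have mem: "\<phi> n p \<in> D n" if "n \<ge> 1" "p \<in> U n" for n p
    using bij[OF that(1)] that(2) by (rule bij_betwE[rule_format])
  have surj: "\<exists>p\<in>U n. a = \<phi> n p" if "n \<ge> 1" "a \<in> D n" for n a
    using bij_betw_imp_surj_on[OF bij[OF that(1)]] that(2) by blast
  have rel: "((m, \<phi> m p), (n, \<phi> n q)) \<in> ind_rel D t \<longleftrightarrow> p = q"
    if "m \<ge> 1" "n \<ge> 1" "p \<in> U m" "q \<in> U n" for m n p q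
  proof -
    have eq: "fold t [m..<k] (\<phi> m p) = fold t [n..<k] (\<phi> n q) \<longleftrightarrow> p = q"
      if k: "m \<le> k" "n \<le> k" for k
      using fold[OF \<open>m \<ge> 1\<close> k(1) \<open>p \<in> U m\<close>] fold[OF \<open>n \<ge> 1\<close> k(2) \<open>q \<in> U n\<close>]
        bij_betw_imp_inj_on[OF bij[of k]] \<open>m \<ge> 1\<close> k by (auto dest: inj_onD)
    have "((m, \<phi> m p), (n, \<phi> n q)) \<in> ind_rel D t \<longleftrightarrow>
      (\<exists>k. m \<le> k \<and> n \<le> k \<and> fold t [m..<k] (\<phi> m p) = fold t [n..<k] (\<phi> n q))"
      using that mem by (simp add: ind_rel_def)
    also have "\<dots> \<longleftrightarrow> p = q"
      using eq[of "max m n"] eq by (metis max.cobounded1 max.cobounded2)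
    finally show ?thesis .
  qed
  \<comment> \<open>The class of \<open>p\<close> has one representative at each stage that contains \<open>p\<close>.\<close>
  define \<Phi> where "\<Phi> p = {(n, \<phi> n p) | n. n \<ge> 1 \<and> p \<in> U n}" for p
  have class_eq: "ind_class D t n (\<phi> n p) = \<Phi> p" if n: "n \<ge> 1" and p: "p \<in> U n" for n p
  proof (intro set_eqI)
    fix mb :: "nat \<times> 'a"
    obtain m b where mb: "mb = (m, b)" by (cases mb)
    have "((n, \<phi> n p), (m, b)) \<in> ind_rel D t \<longleftrightarrow> m \<ge> 1 \<and> p \<in> U m \<and> b = \<phi> m p"
    proof
      assume r: "((n, \<phi> n p), (m, b)) \<in> ind_rel D t"
      then have m: "m \<ge> 1" and "b \<in> D m" by (auto simp: ind_rel_def)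
      then obtain q where q: "q \<in> U m" "b = \<phi> m q" using surj by blast
      then have "p = q" using rel[OF n m p q(1)] r by simp
      then show "m \<ge> 1 \<and> p \<in> U m \<and> b = \<phi> m p" using m q by simp
    next
      assume "m \<ge> 1 \<and> p \<in> U m \<and> b = \<phi> m p"
      then show "((n, \<phi> n p), (m, b)) \<in> ind_rel D t" using rel[OF n _ p, of m p] by simp
    qed
    then show "mb \<in> ind_class D t n (\<phi> n p) \<longleftrightarrow> mb \<in> \<Phi> p"
      by (auto simp: mb ind_class_def \<Phi>_def)
  qed
  have "inj_on \<Phi> (\<Union>n\<in>{1..}. U n)"
  proof
    fix p q assume "p \<in> (\<Union>n\<in>{1..}. U n)" "q \<in> (\<Union>n\<in>{1..}. U n)" and eq: "\<Phi> p = \<Phi> q"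
    then obtain n where n: "n \<ge> 1" "p \<in> U n" by auto
    then have "(n, \<phi> n p) \<in> \<Phi> q" unfolding eq[symmetric] by (auto simp: \<Phi>_def)
    then have "q \<in> U n" "\<phi> n p = \<phi> n q" by (auto simp: \<Phi>_def)
    then show "p = q"
      using n bij_betw_imp_inj_on[OF bij[OF n(1)]] by (auto dest: inj_onD)
  qed
  moreover have "\<Phi> ` (\<Union>n\<in>{1..}. U n) = ind_lim D t"
  proof
    show "\<Phi> ` (\<Union>n\<in>{1..}. U n) \<subseteq> ind_lim D t"
    proof (rule image_subsetI)
      fix p assume "p \<in> (\<Union>n\<in>{1..}. U n)"
      then obtain n where n: "n \<ge> 1" "p \<in> U n" by auto
      then have "ind_class D t n (\<phi> n p) \<in> ind_lim D t"
        unfolding ind_class_def ind_lim_def by (intro quotientI SigmaI mem) auto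
      then show "\<Phi> p \<in> ind_lim D t" using class_eq n by simp
    qed
    show "ind_lim D t \<subseteq> \<Phi> ` (\<Union>n\<in>{1..}. U n)"
    proof
      fix c assume "c \<in> ind_lim D t"
      then obtain n a where n: "n \<ge> 1" "a \<in> D n" and c: "c = ind_class D t n a"
        by (auto simp: ind_lim_def ind_class_def elim!: quotientE)
      then obtain p where "p \<in> U n" "a = \<phi> n p" using surj by blast
      then show "c \<in> \<Phi> ` (\<Union>n\<in>{1..}. U n)" using c class_eq n by auto
    qed
  qed
  ultimately have "bij_betw \<Phi> (\<Union>n\<in>{1..}. U n) (ind_lim D t)"
    by (simp add: bij_betw_def)
  then show ?thesis using class_eq by metis
qed


section \<open>Iterated wreath products\<close>

lemma inj_snoc: "inj snoc"
  by (auto simp: inj_def snoc_def)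

lemma wreath_seq_1: "wreath_seq X 1 = rename_scheme (\<lambda>x. [x]) (\<lambda>i. (1, i)) (X 1)"
  by simp

lemma ident_1: "ident X 1 (i, E) = rename_mat (\<lambda>x. [x]) (pts (X 1)) E"
  by simp

lemma wreath_seq_Suc:
  "n \<ge> 1 \<Longrightarrow> wreath_seq X (Suc n) =
    rename_scheme snoc (tag_rel (Suc n)) (wreath (wreath_seq X n) (X (Suc n)))"
  by (cases n) simp_all

lemma ident_Suc:
  "n \<ge> 1 \<Longrightarrow> ident X (Suc n) (i, E) =
    rename_mat snoc (pts (wreath_seq X n) \<times> pts (X (Suc n)))
      (wreath_ident (wreath_seq X n) (X (Suc n))
        (if i = Suc n then Inr E else Inl (ident X n (i, E))))"
  by (cases n) simp_all

lemma J_upto_Suc_subset: "J_upto X n \<subseteq> J_upto X (Suc n)"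
  by (auto simp: J_upto_def)

lemma J_hat_eq_Union: "J_hat X = (\<Union>n\<in>{1..}. J_upto X n)"
  by (auto simp: J_hat_def J_upto_def)

text \<open>
  The map \<open>ident\<close> sends an idempotent from an earlier summand to the next stage by tensoring with an
  all-ones matrix, exactly as the transition map does.
\<close>

lemma trans_map_ident:
  assumes "n \<ge> 1" "p \<in> J_upto X n"
  shows "trans_map X n (ident X n p) = ident X (Suc n) p"
proof -
  obtain i E where p: "p = (i, E)" by (cases p)
  then have "i \<noteq> Suc n" using assms(2) by (auto simp: J_upto_def)
  then show ?thesis
    by (simp add: p ident_Suc[OF assms(1)] trans_map_def wreath_ident_def)
qed

locale scheme_sequence =
  fixes X :: "nat \<Rightarrow> ('a, 'i) scheme"
  assumes comm: "n \<ge> 1 \<Longrightarrow> comm_assoc_scheme (X n)"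
begin

text \<open>
  The bound on the tags of \<open>V\<close> makes the new tag \<open>Suc n\<close> different from all of them.
\<close>

lemma inj_tag_rel:
  assumes "rels V \<subseteq> {1..n} \<times> UNIV"
  shows "inj_on (tag_rel (Suc n)) (rels (wreath V T))"
  using assms by (auto simp: inj_on_def tag_rel_def wreath_def)

text \<open>
  The bound on the tags belongs to the induction: renaming the relations of the next wreath product
  preserves the scheme axioms only if it is injective.
\<close>

lemma wreath_seq_comm_tagged:
  assumes "n \<ge> 1"
  shows "comm_assoc_scheme (wreath_seq X n) \<and> rels (wreath_seq X n) \<subseteq> {1..n} \<times> UNIV"
  using assms
proof (induction n rule: nat_induct_at_least)
  case base
  interpret renamed_scheme "X 1" "\<lambda>x. [x]" "\<lambda>i. (1::nat, i)"
    by unfold_locales (auto simp: comm inj_on_def)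
  show ?case unfolding wreath_seq_1 using comm_rename rels_rename by auto
next
  case (Suc n)
  interpret wreath_factors "wreath_seq X n" "X (Suc n)"
    using Suc comm by unfold_locales auto
  interpret ren: renamed_scheme W snoc "tag_rel (Suc n)"
    using Suc inj_snoc inj_tag_rel by unfold_locales (auto intro: inj_on_subset)
  have "rels ren.R \<subseteq> {1..Suc n} \<times> UNIV"
    using Suc.IH by (auto simp: ren.rels_rename rels_wreath tag_rel_def)
  then show ?case
    using ren.comm_rename by (simp add: wreath_seq_Suc[OF Suc.hyps])
qed

lemma wreath_factors: "n \<ge> 1 \<Longrightarrow> wreath_factors (wreath_seq X n) (X (Suc n))"
  using wreath_seq_comm_tagged comm by unfold_locales auto

lemma renamed_wreath:
  "n \<ge> 1 \<Longrightarrow> renamed_scheme (wreath (wreath_seq X n) (X (Suc n))) snoc (tag_rel (Suc n))"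
  using wreath_factors.comm_wreath[OF wreath_factors] inj_on_subset[OF inj_snoc subset_UNIV]
    inj_tag_rel[OF wreath_seq_comm_tagged[THEN conjunct2]]
  by unfold_locales

lemma bij_betw_ident:
  assumes "n \<ge> 1"
  shows "bij_betw (ident X n) (J_upto X n) (prim_idems (wreath_seq X n))"
  using assms
proof (induction n rule: nat_induct_at_least)
  case base
  interpret renamed_scheme "X 1" "\<lambda>x. [x]" "\<lambda>i. (1::nat, i)"
    by unfold_locales (auto simp: comm inj_on_def)
  have "bij_betw snd (J_upto X 1) (prim_idems (X 1))"
    by (rule bij_betw_byWitness[where f' = "Pair 1"]) (auto simp: J_upto_def J_summand_def)
  from bij_betw_trans[OF this bij_betw_rename_mat] show ?case
    unfolding wreath_seq_1
    by (rule bij_betw_cong[THEN iffD1, rotated])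
      (simp only: ident_1 o_apply split_paired_all snd_conv)
next
  case (Suc n)
  interpret wreath_factors "wreath_seq X n" "X (Suc n)" by (rule wreath_factors[OF Suc.hyps])
  interpret ren: renamed_scheme W snoc "tag_rel (Suc n)" by (rule renamed_wreath[OF Suc.hyps])
  define h where
    "h p = (if fst p = Suc n then Inr (snd p) else Inl (ident X n p))" for p :: "nat \<times> 'a sqmat"
  have J: "J_upto X (Suc n) = J_upto X n \<union> {Suc n} \<times> (prim_idems (X (Suc n)) - {j0 (X (Suc n))})"
    using Suc.hyps by (auto simp: J_upto_def J_summand_def le_Suc_eq)
  have "bij_betw h (J_upto X n) (Inl ` prim_idems (wreath_seq X n))"
  proof -
    have "bij_betw (Inl \<circ> ident X n) (J_upto X n) (Inl ` prim_idems (wreath_seq X n))"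
      using Suc.IH by (rule bij_betw_trans) (simp add: bij_betw_def)
    then show ?thesis
      by (rule bij_betw_cong[THEN iffD1, rotated]) (auto simp: h_def J_upto_def)
  qed
  moreover have "bij_betw h ({Suc n} \<times> (prim_idems (X (Suc n)) - {j0 (X (Suc n))}))
      (Inr ` (prim_idems (X (Suc n)) - {j0 (X (Suc n))}))"
    by (rule bij_betw_byWitness[where f' = "\<lambda>u. (Suc n, projr u)"]) (auto simp: h_def)
  ultimately have "bij_betw h (J_upto X (Suc n))
      (prim_idems (wreath_seq X n) <+> (prim_idems (X (Suc n)) - {j0 (X (Suc n))}))"
    unfolding J Plus_def by (rule bij_betw_combine) auto
  from bij_betw_trans[OF bij_betw_trans[OF this bij_betw_wreath_ident] ren.bij_betw_rename_mat]
  have "bij_betw (rename_mat snoc (pts W) \<circ> (wreath_ident (wreath_seq X n) (X (Suc n)) \<circ> h))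
      (J_upto X (Suc n)) (prim_idems (wreath_seq X (Suc n)))"
    unfolding wreath_seq_Suc[OF Suc.hyps] .
  then show ?case
    by (rule bij_betw_cong[THEN iffD1, rotated])
      (auto simp: h_def ident_Suc[OF Suc.hyps] pts_wreath)
qed

lemma trans_map_prim_idems:
  assumes "n \<ge> 1" "E \<in> prim_idems (wreath_seq X n)"
  shows "trans_map X n E \<in> prim_idems (wreath_seq X (Suc n))"
proof -
  obtain p where p: "p \<in> J_upto X n" "E = ident X n p"
    using bij_betw_imp_surj_on[OF bij_betw_ident[OF assms(1)]] assms(2) by blast
  then have "p \<in> J_upto X (Suc n)" using J_upto_Suc_subset by blast
  then have "ident X (Suc n) p \<in> prim_idems (wreath_seq X (Suc n))"
    using bij_betwE[OF bij_betw_ident[of "Suc n"]] by auto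
  then show ?thesis by (simp add: p trans_map_ident[OF assms(1)])
qed

lemma pts_wreath_seq_Suc:
  "n \<ge> 1 \<Longrightarrow> pts (wreath_seq X (Suc n)) = snoc ` (pts (wreath_seq X n) \<times> pts (X (Suc n)))"
  by (simp add: wreath_seq_Suc rename_scheme_def wreath_def)

text \<open>
  Points with different first components are related as in the old scheme, under an old tag;
  points with the same first component are related under the tag \<open>Suc n\<close>, which \<open>proj_rel\<close> sends to
  the diagonal relation.
\<close>

lemma rel_proj:
  assumes n: "n \<ge> 1"
    and x: "x \<in> pts (wreath_seq X n)" "x' \<in> pts (wreath_seq X n)"
    and y: "y \<in> pts (X (Suc n))" "y' \<in> pts (X (Suc n))"
  shows "proj_rel X n (rel (wreath_seq X (Suc n)) (snoc (x, y), snoc (x', y')))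
    = rel (wreath_seq X n) (x, x')"
proof -
  interpret wreath_factors "wreath_seq X n" "X (Suc n)" by (rule wreath_factors[OF n])
  interpret ren: renamed_scheme W snoc "tag_rel (Suc n)" by (rule renamed_wreath[OF n])
  have rel: "rel (wreath_seq X (Suc n)) (snoc (x, y), snoc (x', y'))
      = tag_rel (Suc n) (rel W ((x, y), (x', y')))"
    unfolding wreath_seq_Suc[OF n] using x y by (intro ren.rel_rename) (simp_all add: pts_wreath)
  show ?thesis
  proof (cases "x = x'")
    case True
    then show ?thesis
      using x S.rel_eq_diag_rel_iff[of x' x'] rel by (simp add: rel_wreath tag_rel_def proj_rel_def)
  next
    case False
    have "rel (wreath_seq X n) (x, x') \<in> {1..n} \<times> UNIV"
      using S.rel_mem[OF x] wreath_seq_comm_tagged[OF n] by blast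
    then show ?thesis
      using False by (auto simp: rel rel_wreath tag_rel_def proj_rel_def)
  qed
qed

lemma proj_rel_mem:
  assumes n: "n \<ge> 1" and r: "r \<in> rels (wreath_seq X (Suc n))"
  shows "proj_rel X n r \<in> rels (wreath_seq X n)"
proof -
  interpret S: comm_scheme "wreath_seq X n" 
    using wreath_seq_comm_tagged[OF n] by unfold_locales blast
  interpret S': comm_scheme "wreath_seq X (Suc n)"
    by unfold_locales (use wreath_seq_comm_tagged[of "Suc n"] in simp)
  obtain u v where uv: "u \<in> pts (wreath_seq X (Suc n))" "v \<in> pts (wreath_seq X (Suc n))"
    and r_eq: "r = rel (wreath_seq X (Suc n)) (u, v)"
    using r S'.rel_image by blast
  obtain x y x' y' where "u = snoc (x, y)" "v = snoc (x', y')"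
    and "x \<in> pts (wreath_seq X n)" "x' \<in> pts (wreath_seq X n)"
      "y \<in> pts (X (Suc n))" "y' \<in> pts (X (Suc n))"
    using uv unfolding pts_wreath_seq_Suc[OF n] by blast
  then show ?thesis by (simp add: r_eq rel_proj[OF n] S.rel_mem)
qed

lemma scheme_morphism_butlast:
  assumes n: "n \<ge> 1"
  shows "scheme_morphism (wreath_seq X (Suc n)) (wreath_seq X n) butlast (proj_rel X n)"
proof -
  have "butlast (snoc (x, y)) = x" for x and y :: 'a by (simp add: snoc_def)
  then show ?thesis
    unfolding scheme_morphism_def pts_wreath_seq_Suc[OF n]
    using proj_rel_mem[OF n] by (auto simp: rel_proj[OF n])
qed

text \<open>
  Entrywise this is \<open>rel_proj\<close>: an entry of \<open>A \<otimes> J\<close> is the entry of \<open>A\<close> at the projected points.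
\<close>

lemma trans_map_rel_mat:
  assumes n: "n \<ge> 1"
  shows "trans_map X n (rel_mat (wreath_seq X n) c)
    = rel_mat (wreath_seq X (Suc n)) (c \<circ> proj_rel X n)"
  unfolding trans_map_def
proof (rule rename_mat_eqI[symmetric])
  fix p q
  assume "p \<in> pts (wreath_seq X n) \<times> pts (X (Suc n))" "q \<in> pts (wreath_seq X n) \<times> pts (X (Suc n))"
  then show "rel_mat (wreath_seq X (Suc n)) (c \<circ> proj_rel X n) (snoc p, snoc q) =
      tensor (rel_mat (wreath_seq X n) c) (ones_mat (pts (X (Suc n)))) (p, q)"
    by (auto simp: rel_mat_def tensor_def ones_mat_def pts_wreath_seq_Suc[OF n] rel_proj[OF n])
next
  fix u v
  assume "u \<notin> snoc ` (pts (wreath_seq X n) \<times> pts (X (Suc n))) \<or>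
    v \<notin> snoc ` (pts (wreath_seq X n) \<times> pts (X (Suc n)))"
  then show "rel_mat (wreath_seq X (Suc n)) (c \<circ> proj_rel X n) (u, v) = 0"
    unfolding pts_wreath_seq_Suc[OF n, symmetric] by (auto simp: rel_mat_def)
qed (rule inj_on_subset[OF inj_snoc subset_UNIV])

end

theorem proposition4p11:
  fixes X :: "nat \<Rightarrow> ('a, 'i) scheme"
  assumes "\<And>n. n \<ge> 1 \<Longrightarrow> comm_assoc_scheme (X n)"
  shows "(\<forall>n\<ge>1. bij_betw (ident X n) (J_upto X n) (prim_idems (wreath_seq X n))) \<and>
    (\<forall>n\<ge>1. scheme_morphism (wreath_seq X (Suc n)) (wreath_seq X n) butlast (proj_rel X n) \<and>
       (\<forall>c. trans_map X n (rel_mat (wreath_seq X n) c) =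
            rel_mat (wreath_seq X (Suc n)) (c \<circ> proj_rel X n)) \<and>
       trans_map X n \<in> prim_idems (wreath_seq X n) \<rightarrow> prim_idems (wreath_seq X (Suc n))) \<and>
    (\<exists>\<Phi>. bij_betw \<Phi> (J_hat X) (ind_lim (\<lambda>n. prim_idems (wreath_seq X n)) (trans_map X)) \<and>
       (\<forall>n\<ge>1. \<forall>p\<in>J_upto X n.
          \<Phi> p = ind_class (\<lambda>n. prim_idems (wreath_seq X n)) (trans_map X) n (ident X n p)))"
proof -
  interpret scheme_sequence X by unfold_locales (rule assms)
  have lim: "\<exists>\<Phi>. bij_betw \<Phi> (J_hat X)
        (ind_lim (\<lambda>n. prim_idems (wreath_seq X n)) (trans_map X)) \<and>
      (\<forall>n\<ge>1. \<forall>p\<in>J_upto X n.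
        \<Phi> p = ind_class (\<lambda>n. prim_idems (wreath_seq X n)) (trans_map X) n (ident X n p))"
    unfolding J_hat_eq_Union
    by (rule ind_lim_increasing_union) (rule J_upto_Suc_subset bij_betw_ident trans_map_ident; assumption)+
  show ?thesis
    by (intro conjI allI impI funcsetI bij_betw_ident scheme_morphism_butlast trans_map_rel_mat
        trans_map_prim_idems lim)
qed

end
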